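(* Let $t\in\mathbb T$, $x\in l^2_{\mathcal F}(t;\mathbb R^n)$. The following are equivalent: (i) Problem (LQ)$_{tx}$ admits a mixed equilibrium solution; (ii) there is a pair $(\Phi,v)$, $\Phi=(\Phi_k)_{k\in\mathbb T_t}$ deterministic in $\mathbb R^{m\times n}$, $v\in l^2_{\mathcal F}(\mathbb T_t;\mathbb R^m)$, such that for every $k\in\mathbb T_t$ the stationarity condition $$0=\mathcal R_{k,k}(\Phi_kX^{k,\Phi}_k+v_k)+\mathcal B_{k,k}^T\mathbb E_kY^{k,\Phi}_{k+1}+\sum_{i=1}^p(\mathcal D^i_{k,k})^T\mathbb E_k(Y^{k,\Phi}_{k+1}w^i_k)+\rho_{k,k}\quad\text{a.s.}$$ holds and the convexity condition $\widetilde J(k,0;\bar u_k)\ge0$ a.s. holds for all $\bar u_k\in l^2_{\mathcal F}(k;\mathbb R^m)$. Moreover, under these conditions, the pair $(\Phi,v)$ of (ii) is a mixed equilibrium solution of Problem (LQ)$_{tx}$.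
   Context: Standing setup. Fix integers $N,n,m,p\ge1$; $\mathbb T=\{0,1,\dots,N-1\}$ and for $t\in\mathbb T$, $\mathbb T_t=\{t,\dots,N-1\}$. On a probability space $(\Omega,\mathcal F,P)$ let $w_k=(w^1_k,\dots,w^p_k)^T$, $k\in\mathbb T$, be square-integrable random vectors; $\mathcal F_0=\{\emptyset,\Omega\}$, $\mathcal F_k=\sigma\{w_0,\dots,w_{k-1}\}$, $\mathbb E_k[\cdot]=\mathbb E[\cdot\mid\mathcal F_k]$; assume $\mathbb E_k[w_k]=0$ and $\mathbb E_k[w_kw_k^T]=\Delta_k=(\delta^{ij}_k)_{p\times p}$ is deterministic. $l^2_{\mathcal F}(k;\mathbb R^r)$ is the set of $\mathcal F_k$-measurable square-integrable $\mathbb R^r$-valued random vectors, and $l^2_{\mathcal F}(\mathbb T_t;\mathbb R^m)$ the set of sequences $(u_k)_{k\in\mathbb T_t}$ with $u_k\in l^2_{\mathcal F}(k;\mathbb R^m)$. For all $t\in\mathbb T$, $k\in\mathbb T_t$, $i=1,\dots,p$ there are given deterministic data $A_{t,k},\bar A_{t,k},C^i_{t,k},\bar C^i_{t,k}\in\mathbb R^{n\times n}$, $B_{t,k},\bar B_{t,k},D^i_{t,k},\bar D^i_{t,k}\in\mathbb R^{n\times m}$, $f_{t,k},d^i_{t,k}\in\mathbb R^n$, symmetric $Q_{t,k},\bar Q_{t,k}\in\mathbb R^{n\times n}$, symmetric $R_{t,k},\bar R_{t,k}\in\mathbb R^{m\times m}$, symmetric $G_t,\bar G_t\in\mathbb R^{n\times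 n}$, $F_t\in\mathbb R^{n\times n}$, $q_{t,k},g_t\in\mathbb R^n$, $\rho_{t,k}\in\mathbb R^m$. Write $\mathcal A_{t,k}=A_{t,k}+\bar A_{t,k}$, $\mathcal B_{t,k}=B_{t,k}+\bar B_{t,k}$, $\mathcal C^i_{t,k}=C^i_{t,k}+\bar C^i_{t,k}$, $\mathcal D^i_{t,k}=D^i_{t,k}+\bar D^i_{t,k}$, $\mathcal Q_{t,k}=Q_{t,k}+\bar Q_{t,k}$, $\mathcal R_{t,k}=R_{t,k}+\bar R_{t,k}$, $\mathcal G_t=G_t+\bar G_t$. $M^\dagger$ denotes the Moore–Penrose inverse, $\mathrm{Ran}$ the range, $\succeq0$ ($\succ0$) positive semidefinite (definite). For $s\in\mathbb T$, $\xi\in l^2_{\mathcal F}(s;\mathbb R^n)$ and $u=(u_k)_{k\in\mathbb T_s}$ (adapted, square integrable), the state starting from the initial pair $(s,\xi)$ is $X_s=\xi$, $X_{k+1}=A_{s,k}X_k+\bar A_{s,k}\mathbb E_sX_k+B_{s,k}u_k+\bar B_{s,k}\mathbb E_su_k+f_{s,k}+\sum_{i=1}^p\big(C^i_{s,k}X_k+\bar C^i_{s,k}\mathbb E_sX_k+D^i_{s,k}u_k+\bar D^i_{s,k}\mathbb E_su_k+d^i_{s,k}\big)w^i_k$, $k\in\mathbb T_s$ (a control may also be given in feedback form $u_k=\Phi_kX_k+v_k$, in which case the recursion is solved with this $u_k$), and the cost is the $\mathcal F_s$-measurable random variable $J(s,\xi;u)=\sum_{k=s}^{N-1}\mathbb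 E_s\big[X_k^TQ_{s,k}X_k+(\mathbb E_sX_k)^T\bar Q_{s,k}\mathbb E_sX_k+u_k^TR_{s,k}u_k+(\mathbb E_su_k)^T\bar R_{s,k}\mathbb E_su_k+2q_{s,k}^TX_k+2\rho_{s,k}^Tu_k\big]+\mathbb E_s[X_N^TG_sX_N]+(\mathbb E_sX_N)^T\bar G_s\mathbb E_sX_N+2(F_s\xi+g_s)^T\mathbb E_sX_N$. Problem (LQ)$_{tx}$ is this problem with initial pair $(t,x)$. (In)equalities between random variables are understood almost surely. Mixed equilibrium solution. Let $t\in\mathbb T$, $x\in l^2_{\mathcal F}(t;\mathbb R^n)$, $\Phi=(\Phi_k)_{k\in\mathbb T_t}$ deterministic matrices in $\mathbb R^{m\times n}$ and $v=(v_k)_{k\in\mathbb T_t}\in l^2_{\mathcal F}(\mathbb T_t;\mathbb R^m)$. The equilibrium state $X^*=X^{t,x,*}$ is $X^*_t=x$, $X^*_{k+1}=(\mathcal A_{k,k}+\mathcal B_{k,k}\Phi_k)X^*_k+\mathcal B_{k,k}v_k+f_{k,k}+\sum_{i=1}^p\big[(\mathcal C^i_{k,k}+\mathcal D^i_{k,k}\Phi_k)X^*_k+\mathcal D^i_{k,k}v_k+d^i_{k,k}\big]w^i_k$, $k\in\mathbb T_t$. For $k\in\mathbb T_t$, $X^{k,\Phi}$ is the state from the initial pair $(k,X^*_k)$ under the feedback control $u_\ell=\Phi_\ell X_\ell+v_\ell$, $\ell\in\mathbb T_k$; for $u_k\in l^2_{\mathcal F}(k;\mathbb R^m)$, $X^{k,u_k,\Phi}$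 is the state from $(k,X^*_k)$ under $u_k$ at time $k$ and $u_\ell=\Phi_\ell X_\ell+v_\ell$ for $\ell\in\mathbb T_{k+1}$. The pair $(\Phi,v)$ (pure-feedback-strategy part $\Phi$, independent of $x$; open-loop-control part $v$, which may depend on $x$) is a mixed equilibrium solution of Problem (LQ)$_{tx}$ if for every $k\in\mathbb T_t$ and $u_k\in l^2_{\mathcal F}(k;\mathbb R^m)$: $J\big(k,X^*_k;(\Phi_\ell X^{k,\Phi}_\ell+v_\ell)_{\ell\in\mathbb T_k}\big)\le J\big(k,X^*_k;(u_k,(\Phi_\ell X^{k,u_k,\Phi}_\ell+v_\ell)_{\ell\in\mathbb T_{k+1}})\big)$ a.s. The process $Y^{k,\Phi}$ is defined backward by $Y^{k,\Phi}_N=G_kX^{k,\Phi}_N+\bar G_k\mathbb E_kX^{k,\Phi}_N+F_kX^*_k+g_k$ and, for $\ell\in\mathbb T_k$, $Y^{k,\Phi}_\ell=(Q_{k,\ell}+\Phi_\ell^TR_{k,\ell}\Phi_\ell)X^{k,\Phi}_\ell+(\bar Q_{k,\ell}+\Phi_\ell^T\bar R_{k,\ell}\Phi_\ell)\mathbb E_kX^{k,\Phi}_\ell+\Phi_\ell^TR_{k,\ell}v_\ell+\Phi_\ell^T\bar R_{k,\ell}\mathbb E_kv_\ell+(A_{k,\ell}+B_{k,\ell}\Phi_\ell)^T\mathbb E_\ell Y^{k,\Phi}_{\ell+1}+(\bar A_{k,\ell}+\bar B_{k,\ell}\Phi_\ell)^T\mathbb E_kY^{k,\Phi}_{\ell+1}+\sum_{i=1}^p\big[(C^i_{k,\ell}+D^i_{k,\ell}\Phi_\ell)^T\mathbb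 E_\ell(Y^{k,\Phi}_{\ell+1}w^i_\ell)+(\bar C^i_{k,\ell}+\bar D^i_{k,\ell}\Phi_\ell)^T\mathbb E_k(Y^{k,\Phi}_{\ell+1}w^i_\ell)\big]+\Phi_\ell^T\rho_{k,\ell}+q_{k,\ell}$. For $\bar u_k\in l^2_{\mathcal F}(k;\mathbb R^m)$, the process $\alpha=\alpha^{k,\bar u_k}$ is: $\alpha_k=0$, $\alpha_{k+1}=\mathcal B_{k,k}\bar u_k+\sum_{i}\mathcal D^i_{k,k}\bar u_kw^i_k$, and for $\ell\in\mathbb T_{k+1}$: $\alpha_{\ell+1}=(A_{k,\ell}+B_{k,\ell}\Phi_\ell)\alpha_\ell+(\bar A_{k,\ell}+\bar B_{k,\ell}\Phi_\ell)\mathbb E_k\alpha_\ell+\sum_i\big[(C^i_{k,\ell}+D^i_{k,\ell}\Phi_\ell)\alpha_\ell+(\bar C^i_{k,\ell}+\bar D^i_{k,\ell}\Phi_\ell)\mathbb E_k\alpha_\ell\big]w^i_\ell$, and $\widetilde J(k,0;\bar u_k)=\sum_{\ell=k}^{N-1}\mathbb E_k\big[\alpha_\ell^T(Q_{k,\ell}+\Phi_\ell^TR_{k,\ell}\Phi_\ell)\alpha_\ell+(\mathbb E_k\alpha_\ell)^T(\bar Q_{k,\ell}+\Phi_\ell^T\bar R_{k,\ell}\Phi_\ell)\mathbb E_k\alpha_\ell\big]+\mathbb E_k[\bar u_k^T\mathcal R_{k,k}\bar u_k]+\mathbb E_k[\alpha_N^TG_k\alpha_N]+(\mathbb E_k\alpha_N)^T\bar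 G_k\mathbb E_k\alpha_N$. *)

theory Defs
  imports "HOL-Probability.Probability"
begin

text \<open>Discrete-time time-inconsistent mean-field LQ problem with multiplicative noise.
  State dimension n, control dimension m and noise dimension p are rendered as
  finite index types 'n, 'm, 'p.  Matrices of size r x c are of type real^'c^'r.\<close>

record ('n::finite, 'm::finite, 'p::finite) lqdata =
  mA  :: "nat \<Rightarrow> nat \<Rightarrow> real^'n^'n"
  mAb :: "nat \<Rightarrow> nat \<Rightarrow> real^'n^'n"
  mB  :: "nat \<Rightarrow> nat \<Rightarrow> real^'m^'n"
  mBb :: "nat \<Rightarrow> nat \<Rightarrow> real^'m^'n"
  mC  :: "'p \<Rightarrow> nat \<Rightarrow> nat \<Rightarrow> real^'n^'n"
  mCb :: "'p \<Rightarrow> nat \<Rightarrow> nat \<Rightarrow> real^'n^'n"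
  mD  :: "'p \<Rightarrow> nat \<Rightarrow> nat \<Rightarrow> real^'m^'n"
  mDb :: "'p \<Rightarrow> nat \<Rightarrow> nat \<Rightarrow> real^'m^'n"
  vf  :: "nat \<Rightarrow> nat \<Rightarrow> real^'n"
  vd  :: "'p \<Rightarrow> nat \<Rightarrow> nat \<Rightarrow> real^'n"
  mQ  :: "nat \<Rightarrow> nat \<Rightarrow> real^'n^'n"
  mQb :: "nat \<Rightarrow> nat \<Rightarrow> real^'n^'n"
  mR  :: "nat \<Rightarrow> nat \<Rightarrow> real^'m^'m"
  mRb :: "nat \<Rightarrow> nat \<Rightarrow> real^'m^'m"
  mG  :: "nat \<Rightarrow> real^'n^'n"
  mGb :: "nat \<Rightarrow> real^'n^'n"
  mF  :: "nat \<Rightarrow> real^'n^'n"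
  vq  :: "nat \<Rightarrow> nat \<Rightarrow> real^'n"
  vg  :: "nat \<Rightarrow> real^'n"
  vrho :: "nat \<Rightarrow> nat \<Rightarrow> real^'m"

definition Fk :: "'a measure \<Rightarrow> (nat \<Rightarrow> 'a \<Rightarrow> real^'p::finite) \<Rightarrow> nat \<Rightarrow> 'a measure" where
  "Fk M w k = sigma (space M) {w j -` B \<inter> space M | j B. j < k \<and> B \<in> sets borel}"

definition CEv :: "'a measure \<Rightarrow> 'a measure \<Rightarrow> ('a \<Rightarrow> real^'r::finite) \<Rightarrow> 'a \<Rightarrow> real^'r" where
  "CEv M F X = (\<lambda>\<omega>. \<chi> i. real_cond_exp M F (\<lambda>\<eta>. X \<eta> $ i) \<omega>)"

definition L2F :: "'a measure \<Rightarrow> (nat \<Rightarrow> 'a \<Rightarrow> real^'p::finite) \<Rightarrow> nat \<Rightarrow> ('a \<Rightarrow> real^'r::finite) \<Rightarrow> bool" where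
  "L2F M w k X \<longleftrightarrow> X \<in> borel_measurable (Fk M w k) \<and> integrable M (\<lambda>\<omega>. (norm (X \<omega>))\<^sup>2)"

definition "cA L t k = mA L t k + mAb L t k"
definition "cB L t k = mB L t k + mBb L t k"
definition "cC L i t k = mC L i t k + mCb L i t k"
definition "cD L i t k = mD L i t k + mDb L i t k"
definition "cR L t k = mR L t k + mRb L t k"

text \<open>A control policy U maps (time, current state random vector) to the control random
  vector at that time; it covers open-loop, feedback and mixed controls.\<close>
type_synonym ('a,'n,'m) policy = "nat \<Rightarrow> ('a \<Rightarrow> real^'n) \<Rightarrow> ('a \<Rightarrow> real^'m)"

fun stateJ :: "'a measure \<Rightarrow> (nat \<Rightarrow> 'a \<Rightarrow> real^'p::finite) \<Rightarrow> ('n::finite,'m::finite,'p) lqdata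
   \<Rightarrow> nat \<Rightarrow> ('a \<Rightarrow> real^'n) \<Rightarrow> ('a,'n,'m) policy \<Rightarrow> nat \<Rightarrow> ('a \<Rightarrow> real^'n)" where
  "stateJ M w L s \<xi> U 0 = \<xi>"
| "stateJ M w L s \<xi> U (Suc j) =
     (let k = s + j; X = stateJ M w L s \<xi> U j; u = U k X;
          EXs = CEv M (Fk M w s) X; Eu = CEv M (Fk M w s) u
      in (\<lambda>\<omega>. mA L s k *v X \<omega> + mAb L s k *v EXs \<omega> + mB L s k *v u \<omega> + mBb L s k *v Eu \<omega> + vf L s k
          + (\<Sum>i\<in>UNIV. (w k \<omega> $ i) *\<^sub>R
               (mC L i s k *v X \<omega> + mCb L i s k *v EXs \<omega> + mD L i s k *v u \<omega>
                + mDb L i s k *v Eu \<omega> + vd L i s k))))"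

definition state :: "'a measure \<Rightarrow> (nat \<Rightarrow> 'a \<Rightarrow> real^'p::finite) \<Rightarrow> ('n::finite,'m::finite,'p) lqdata
   \<Rightarrow> nat \<Rightarrow> ('a \<Rightarrow> real^'n) \<Rightarrow> ('a,'n,'m) policy \<Rightarrow> nat \<Rightarrow> ('a \<Rightarrow> real^'n)" where
  "state M w L s \<xi> U k = stateJ M w L s \<xi> U (k - s)"

definition Jcost :: "'a measure \<Rightarrow> (nat \<Rightarrow> 'a \<Rightarrow> real^'p::finite) \<Rightarrow> ('n::finite,'m::finite,'p) lqdata
   \<Rightarrow> nat \<Rightarrow> nat \<Rightarrow> ('a \<Rightarrow> real^'n) \<Rightarrow> ('a,'n,'m) policy \<Rightarrow> 'a \<Rightarrow> real" where
  "Jcost M w L N s \<xi> U =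
    (let X = state M w L s \<xi> U; Fs = Fk M w s; u = (\<lambda>k. U k (X k)) in
     (\<lambda>\<omega>. (\<Sum>k=s..<N. real_cond_exp M Fs (\<lambda>\<eta>.
              X k \<eta> \<bullet> (mQ L s k *v X k \<eta>) + CEv M Fs (X k) \<eta> \<bullet> (mQb L s k *v CEv M Fs (X k) \<eta>)
            + u k \<eta> \<bullet> (mR L s k *v u k \<eta>) + CEv M Fs (u k) \<eta> \<bullet> (mRb L s k *v CEv M Fs (u k) \<eta>)
            + 2 * (vq L s k \<bullet> X k \<eta>) + 2 * (vrho L s k \<bullet> u k \<eta>)) \<omega>)
        + real_cond_exp M Fs (\<lambda>\<eta>. X N \<eta> \<bullet> (mG L s *v X N \<eta>)) \<omega>
        + CEv M Fs (X N) \<omega> \<bullet> (mGb L s *v CEv M Fs (X N) \<omega>)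
        + 2 * ((mF L s *v \<xi> \<omega> + vg L s) \<bullet> CEv M Fs (X N) \<omega>)))"

fun eqstJ :: "(nat \<Rightarrow> 'a \<Rightarrow> real^'p::finite) \<Rightarrow> ('n::finite,'m::finite,'p) lqdata
   \<Rightarrow> nat \<Rightarrow> ('a \<Rightarrow> real^'n) \<Rightarrow> (nat \<Rightarrow> real^'n^'m) \<Rightarrow> (nat \<Rightarrow> 'a \<Rightarrow> real^'m) \<Rightarrow> nat \<Rightarrow> ('a \<Rightarrow> real^'n)" where
  "eqstJ w L t x \<Phi> v 0 = x"
| "eqstJ w L t x \<Phi> v (Suc j) =
     (let k = t + j; X = eqstJ w L t x \<Phi> v j in
      (\<lambda>\<omega>. (cA L k k + cB L k k ** \<Phi> k) *v X \<omega> + cB L k k *v v k \<omega> + vf L k k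
         + (\<Sum>i\<in>UNIV. (w k \<omega> $ i) *\<^sub>R
              ((cC L i k k + cD L i k k ** \<Phi> k) *v X \<omega> + cD L i k k *v v k \<omega> + vd L i k k))))"

definition eqst :: "(nat \<Rightarrow> 'a \<Rightarrow> real^'p::finite) \<Rightarrow> ('n::finite,'m::finite,'p) lqdata
   \<Rightarrow> nat \<Rightarrow> ('a \<Rightarrow> real^'n) \<Rightarrow> (nat \<Rightarrow> real^'n^'m) \<Rightarrow> (nat \<Rightarrow> 'a \<Rightarrow> real^'m) \<Rightarrow> nat \<Rightarrow> ('a \<Rightarrow> real^'n)" where
  "eqst w L t x \<Phi> v k = eqstJ w L t x \<Phi> v (k - t)"

definition fbU :: "(nat \<Rightarrow> real^'n::finite^'m::finite) \<Rightarrow> (nat \<Rightarrow> 'a \<Rightarrow> real^'m) \<Rightarrow> ('a,'n,'m) policy" where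
  "fbU \<Phi> v = (\<lambda>l X \<omega>. \<Phi> l *v X \<omega> + v l \<omega>)"

definition mixU :: "nat \<Rightarrow> ('a \<Rightarrow> real^'m) \<Rightarrow> (nat \<Rightarrow> real^'n::finite^'m::finite) \<Rightarrow> (nat \<Rightarrow> 'a \<Rightarrow> real^'m) \<Rightarrow> ('a,'n,'m) policy" where
  "mixU k u \<Phi> v = (\<lambda>l X. if l = k then u else fbU \<Phi> v l X)"

definition Xfb :: "'a measure \<Rightarrow> (nat \<Rightarrow> 'a \<Rightarrow> real^'p::finite) \<Rightarrow> ('n::finite,'m::finite,'p) lqdata
   \<Rightarrow> nat \<Rightarrow> ('a \<Rightarrow> real^'n) \<Rightarrow> (nat \<Rightarrow> real^'n^'m) \<Rightarrow> (nat \<Rightarrow> 'a \<Rightarrow> real^'m) \<Rightarrow> nat \<Rightarrow> nat \<Rightarrow> ('a \<Rightarrow> real^'n)" where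
  "Xfb M w L t x \<Phi> v k = state M w L k (eqst w L t x \<Phi> v k) (fbU \<Phi> v)"

definition mixed_equilibrium :: "'a measure \<Rightarrow> (nat \<Rightarrow> 'a \<Rightarrow> real^'p::finite) \<Rightarrow> ('n::finite,'m::finite,'p) lqdata
   \<Rightarrow> nat \<Rightarrow> nat \<Rightarrow> ('a \<Rightarrow> real^'n) \<Rightarrow> (nat \<Rightarrow> real^'n^'m) \<Rightarrow> (nat \<Rightarrow> 'a \<Rightarrow> real^'m) \<Rightarrow> bool" where
  "mixed_equilibrium M w L N t x \<Phi> v \<longleftrightarrow>
     (\<forall>k. t \<le> k \<and> k < N \<longrightarrow> L2F M w k (v k)) \<and>
     (\<forall>k u. t \<le> k \<and> k < N \<and> L2F M w k u \<longrightarrow>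
        (AE \<omega> in M. Jcost M w L N k (eqst w L t x \<Phi> v k) (fbU \<Phi> v) \<omega>
                   \<le> Jcost M w L N k (eqst w L t x \<Phi> v k) (mixU k u \<Phi> v) \<omega>))"

fun YJ :: "'a measure \<Rightarrow> (nat \<Rightarrow> 'a \<Rightarrow> real^'p::finite) \<Rightarrow> ('n::finite,'m::finite,'p) lqdata
   \<Rightarrow> nat \<Rightarrow> nat \<Rightarrow> ('a \<Rightarrow> real^'n) \<Rightarrow> (nat \<Rightarrow> real^'n^'m) \<Rightarrow> (nat \<Rightarrow> 'a \<Rightarrow> real^'m)
   \<Rightarrow> nat \<Rightarrow> nat \<Rightarrow> ('a \<Rightarrow> real^'n)" where
  "YJ M w L N t x \<Phi> v k 0 =
     (let X = Xfb M w L t x \<Phi> v k N; Fkk = Fk M w k in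
      (\<lambda>\<omega>. mG L k *v X \<omega> + mGb L k *v CEv M Fkk X \<omega> + mF L k *v eqst w L t x \<Phi> v k \<omega> + vg L k))"
| "YJ M w L N t x \<Phi> v k (Suc j) =
     (let l = N - Suc j; Y' = YJ M w L N t x \<Phi> v k j; X = Xfb M w L t x \<Phi> v k l;
          Fkk = Fk M w k; Fl = Fk M w l in
      (\<lambda>\<omega>. (mQ L k l + transpose (\<Phi> l) ** mR L k l ** \<Phi> l) *v X \<omega>
         + (mQb L k l + transpose (\<Phi> l) ** mRb L k l ** \<Phi> l) *v CEv M Fkk X \<omega>
         + transpose (\<Phi> l) *v (mR L k l *v v l \<omega>)
         + transpose (\<Phi> l) *v (mRb L k l *v CEv M Fkk (v l) \<omega>)
         + transpose (mA L k l + mB L k l ** \<Phi> l) *v CEv M Fl Y' \<omega>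
         + transpose (mAb L k l + mBb L k l ** \<Phi> l) *v CEv M Fkk Y' \<omega>
         + (\<Sum>i\<in>UNIV. transpose (mC L i k l + mD L i k l ** \<Phi> l) *v CEv M Fl (\<lambda>\<eta>. (w l \<eta> $ i) *\<^sub>R Y' \<eta>) \<omega>
             + transpose (mCb L i k l + mDb L i k l ** \<Phi> l) *v CEv M Fkk (\<lambda>\<eta>. (w l \<eta> $ i) *\<^sub>R Y' \<eta>) \<omega>)
         + transpose (\<Phi> l) *v vrho L k l + vq L k l))"

definition Yproc :: "'a measure \<Rightarrow> (nat \<Rightarrow> 'a \<Rightarrow> real^'p::finite) \<Rightarrow> ('n::finite,'m::finite,'p) lqdata
   \<Rightarrow> nat \<Rightarrow> nat \<Rightarrow> ('a \<Rightarrow> real^'n) \<Rightarrow> (nat \<Rightarrow> real^'n^'m) \<Rightarrow> (nat \<Rightarrow> 'a \<Rightarrow> real^'m)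
   \<Rightarrow> nat \<Rightarrow> nat \<Rightarrow> ('a \<Rightarrow> real^'n)" where
  "Yproc M w L N t x \<Phi> v k l = YJ M w L N t x \<Phi> v k (N - l)"

fun alphaJ :: "'a measure \<Rightarrow> (nat \<Rightarrow> 'a \<Rightarrow> real^'p::finite) \<Rightarrow> ('n::finite,'m::finite,'p) lqdata
   \<Rightarrow> nat \<Rightarrow> (nat \<Rightarrow> real^'n^'m) \<Rightarrow> ('a \<Rightarrow> real^'m) \<Rightarrow> nat \<Rightarrow> ('a \<Rightarrow> real^'n)" where
  "alphaJ M w L k \<Phi> ub 0 = (\<lambda>\<omega>. 0)"
| "alphaJ M w L k \<Phi> ub (Suc j) =
     (let l = k + j; a = alphaJ M w L k \<Phi> ub j; Fkk = Fk M w k in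
      if j = 0 then
        (\<lambda>\<omega>. cB L k k *v ub \<omega> + (\<Sum>i\<in>UNIV. (w k \<omega> $ i) *\<^sub>R (cD L i k k *v ub \<omega>)))
      else
        (\<lambda>\<omega>. (mA L k l + mB L k l ** \<Phi> l) *v a \<omega> + (mAb L k l + mBb L k l ** \<Phi> l) *v CEv M Fkk a \<omega>
           + (\<Sum>i\<in>UNIV. (w l \<omega> $ i) *\<^sub>R
                ((mC L i k l + mD L i k l ** \<Phi> l) *v a \<omega>
                 + (mCb L i k l + mDb L i k l ** \<Phi> l) *v CEv M Fkk a \<omega>))))"

definition alpha :: "'a measure \<Rightarrow> (nat \<Rightarrow> 'a \<Rightarrow> real^'p::finite) \<Rightarrow> ('n::finite,'m::finite,'p) lqdata
   \<Rightarrow> nat \<Rightarrow> (nat \<Rightarrow> real^'n^'m) \<Rightarrow> ('a \<Rightarrow> real^'m) \<Rightarrow> nat \<Rightarrow> ('a \<Rightarrow> real^'n)" where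
  "alpha M w L k \<Phi> ub l = alphaJ M w L k \<Phi> ub (l - k)"

definition Jtilde :: "'a measure \<Rightarrow> (nat \<Rightarrow> 'a \<Rightarrow> real^'p::finite) \<Rightarrow> ('n::finite,'m::finite,'p) lqdata
   \<Rightarrow> nat \<Rightarrow> nat \<Rightarrow> (nat \<Rightarrow> real^'n^'m) \<Rightarrow> ('a \<Rightarrow> real^'m) \<Rightarrow> 'a \<Rightarrow> real" where
  "Jtilde M w L N k \<Phi> ub =
    (let a = alpha M w L k \<Phi> ub; Fs = Fk M w k in
     (\<lambda>\<omega>. (\<Sum>l=k..<N. real_cond_exp M Fs (\<lambda>\<eta>.
              a l \<eta> \<bullet> ((mQ L k l + transpose (\<Phi> l) ** mR L k l ** \<Phi> l) *v a l \<eta>)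
            + CEv M Fs (a l) \<eta> \<bullet> ((mQb L k l + transpose (\<Phi> l) ** mRb L k l ** \<Phi> l) *v CEv M Fs (a l) \<eta>)) \<omega>)
        + real_cond_exp M Fs (\<lambda>\<eta>. ub \<eta> \<bullet> (cR L k k *v ub \<eta>)) \<omega>
        + real_cond_exp M Fs (\<lambda>\<eta>. a N \<eta> \<bullet> (mG L k *v a N \<eta>)) \<omega>
        + CEv M Fs (a N) \<omega> \<bullet> (mGb L k *v CEv M Fs (a N) \<omega>)))"

definition stationarity :: "'a measure \<Rightarrow> (nat \<Rightarrow> 'a \<Rightarrow> real^'p::finite) \<Rightarrow> ('n::finite,'m::finite,'p) lqdata
   \<Rightarrow> nat \<Rightarrow> nat \<Rightarrow> ('a \<Rightarrow> real^'n) \<Rightarrow> (nat \<Rightarrow> real^'n^'m) \<Rightarrow> (nat \<Rightarrow> 'a \<Rightarrow> real^'m) \<Rightarrow> nat \<Rightarrow> bool" where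
  "stationarity M w L N t x \<Phi> v k \<longleftrightarrow>
     (let Y = Yproc M w L N t x \<Phi> v k (Suc k); Fkk = Fk M w k in
      AE \<omega> in M. 0 = cR L k k *v (\<Phi> k *v Xfb M w L t x \<Phi> v k k \<omega> + v k \<omega>)
                     + transpose (cB L k k) *v CEv M Fkk Y \<omega>
                     + (\<Sum>i\<in>UNIV. transpose (cD L i k k) *v CEv M Fkk (\<lambda>\<eta>. (w k \<eta> $ i) *\<^sub>R Y \<eta>) \<omega>)
                     + vrho L k k)"

definition convexity :: "'a measure \<Rightarrow> (nat \<Rightarrow> 'a \<Rightarrow> real^'p::finite) \<Rightarrow> ('n::finite,'m::finite,'p) lqdata
   \<Rightarrow> nat \<Rightarrow> (nat \<Rightarrow> real^'n^'m) \<Rightarrow> nat \<Rightarrow> bool" where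
  "convexity M w L N \<Phi> k \<longleftrightarrow>
     (\<forall>ub. L2F M w k ub \<longrightarrow> (AE \<omega> in M. Jtilde M w L N k \<Phi> ub \<omega> \<ge> 0))"

definition standing :: "'a measure \<Rightarrow> (nat \<Rightarrow> 'a \<Rightarrow> real^'p::finite) \<Rightarrow> (nat \<Rightarrow> real^'p^'p)
   \<Rightarrow> ('n::finite,'m::finite,'p) lqdata \<Rightarrow> nat \<Rightarrow> bool" where
  "standing M w \<Delta> L N \<longleftrightarrow>
     prob_space M \<and>
     (\<forall>k<N. w k \<in> borel_measurable M \<and> integrable M (\<lambda>\<omega>. (norm (w k \<omega>))\<^sup>2)) \<and>
     (\<forall>k<N. AE \<omega> in M. CEv M (Fk M w k) (w k) \<omega> = 0) \<and>
     (\<forall>k<N. AE \<omega> in M. (\<chi> i j. real_cond_exp M (Fk M w k) (\<lambda>\<eta>. w k \<eta> $ i * w k \<eta> $ j) \<omega>) = \<Delta> k) \<and>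
     (\<forall>t k. t \<le> k \<and> k < N \<longrightarrow>
        transpose (mQ L t k) = mQ L t k \<and> transpose (mQb L t k) = mQb L t k \<and>
        transpose (mR L t k) = mR L t k \<and> transpose (mRb L t k) = mRb L t k) \<and>
     (\<forall>t<N. transpose (mG L t) = mG L t \<and> transpose (mGb L t) = mGb L t)"

end

theory Submission
  imports Defs
begin

text \<open>Fix a time \<open>k\<close> and perturb the control at \<open>k\<close> alone by \<open>ub\<close>, all later controls keeping their
  feedback form. By linearity the state changes by \<open>\<alpha>\<close>, so the cost changes by its quadratic part
  \<open>Jtilde\<close> plus a term linear in \<open>\<alpha>\<close>. The process \<open>Y\<close> is the adjoint of \<open>\<alpha>\<close>: telescoping the conditional
  expectations of \<open>\<alpha>\<^sub>l \<bullet> Y\<^sub>l\<close> turns the linear term into \<open>2 ub \<bullet> S\<close>, where \<open>S\<close> is the right-hand side of the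
  stationarity condition. Hence equilibrium at \<open>k\<close> means \<open>Jtilde ub + 2 ub \<bullet> S \<ge> 0\<close> for all \<open>ub\<close>. Comparing
  \<open>ub\<close> with \<open>-ub\<close> yields convexity, and \<open>ub = -S/n\<close> with \<open>n \<rightarrow> \<infinity>\<close> yields \<open>S = 0\<close>.

  Almost sure identities between \<open>F k\<close>-measurable variables are proved by comparing integrals over
  every event \<open>A\<close> of \<open>F k\<close>, so that the computation takes place with the real-valued bilinear
  form \<open>ip A\<close>.\<close>

section \<open>Conditional expectations and square integrability\<close>

text \<open>The delicate point is integrability: a product of two square-integrable variables is in
  general only integrable, while the dynamics multiply by the noise at every step. Two facts keep
  all processes square integrable, and both rest on the deterministic conditional covariance. If X
  is measurable at time l, then \<open>w l\<close> times X is square integrable, because the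
  conditional second moment of \<open>w l\<close> is a constant. If Y is measurable only at time
  l+1, it may depend on \<open>w l\<close> and the product may fail to be square integrable; its
  conditional expectation at time l still is, by a conditional Cauchy-Schwarz inequality.
  Integration over events does more than decide equality: for A in \<open>F k\<close> every
  conditional expectation at a time l \<ge> k is self-adjoint for \<open>ip A\<close>. Mean-field
  and noise terms can therefore be transposed like matrices, which is where the shape of Y comes
  from. Once (\<Phi>, v) is fixed, the conditions at different times k decouple, so one k is treated
  at a time.\<close>

lemma (in sigma_finite_subalgebra) nn_cond_exp_eq_real_cond_exp:
  assumes g: "integrable M g" and g0: "\<And>x. 0 \<le> g x"
  shows "AE x in M. nn_cond_exp M F (\<lambda>x. ennreal (g x)) x = ennreal (real_cond_exp M F g x)"
proof -
  have [measurable]: "g \<in> borel_measurable M" using g by auto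
  have "(\<lambda>x. ennreal (- g x)) = (\<lambda>x. 0)" using g0 by (simp add: ennreal_neg)
  moreover have "AE x in M. 0 = nn_cond_exp M F (\<lambda>x. 0) x"
    by (rule nn_cond_exp_F_meas, auto)
  ultimately have neg: "AE x in M. nn_cond_exp M F (\<lambda>x. ennreal (- g x)) x = 0" by simp
  have "(\<integral>\<^sup>+ x. nn_cond_exp M F (\<lambda>x. ennreal (g x)) x \<partial>M) = (\<integral>\<^sup>+ x. ennreal (g x) \<partial>M)"
    using nn_cond_exp_intg[of "\<lambda>_. 1" "\<lambda>x. ennreal (g x)"] by simp
  also have "\<dots> \<noteq> \<infinity>"
    using g g0 by (simp add: integrable_iff_bounded top.not_eq_extremum)
  \<comment> \<open>\<open>real_cond_exp\<close> passes through \<open>enn2real\<close>, which sends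
    infinity to 0; the two notions agree only where the value is finite.\<close>
  finally have "AE x in M. nn_cond_exp M F (\<lambda>x. ennreal (g x)) x \<noteq> \<infinity>"
    by (intro nn_integral_PInf_AE) auto
  with neg show ?thesis
    by eventually_elim (simp add: real_cond_exp_def top.not_eq_extremum)
qed

lemma (in sigma_finite_subalgebra) integrable_mult_cond_exp_bounded:
  assumes f: "f \<in> borel_measurable F" "integrable M f" "\<And>x. 0 \<le> f x"
    and g: "integrable M g" "\<And>x. 0 \<le> g x"
    and D: "AE x in M. real_cond_exp M F g x \<le> D"
  shows "integrable M (\<lambda>x. f x * g x)"
proof (rule integrableI_nonneg)
  have [measurable]: "f \<in> borel_measurable F" "f \<in> borel_measurable M" "g \<in> borel_measurable M"
    using f g by auto
  show "(\<lambda>x. f x * g x) \<in> borel_measurable M" by measurable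
  show "AE x in M. 0 \<le> f x * g x" using f g by auto
  have "(\<integral>\<^sup>+ x. ennreal (f x * g x) \<partial>M) = (\<integral>\<^sup>+ x. ennreal (f x) * ennreal (g x) \<partial>M)"
    using f(3) g(2) by (simp add: ennreal_mult)
  also have "\<dots> = (\<integral>\<^sup>+ x. ennreal (f x) * nn_cond_exp M F (\<lambda>x. ennreal (g x)) x \<partial>M)"
    by (rule nn_cond_exp_intg[symmetric]) measurable
  also have "\<dots> \<le> (\<integral>\<^sup>+ x. ennreal (f x) * ennreal D \<partial>M)"
    using nn_cond_exp_eq_real_cond_exp[OF g] D
    by (intro nn_integral_mono_AE) (auto intro!: mult_left_mono ennreal_leI)
  also have "\<dots> = (\<integral>\<^sup>+ x. ennreal (f x) \<partial>M) * ennreal D"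
    by (rule nn_integral_multc) measurable
  also have "\<dots> < \<infinity>"
    using f(2,3) by (simp add: integrable_iff_bounded ennreal_mult_less_top)
  finally show "(\<integral>\<^sup>+ x. ennreal (f x * g x) \<partial>M) < \<infinity>" .
qed

lemma integrable_mult_of_squares:
  fixes f g :: "'a \<Rightarrow> real"
  assumes [measurable]: "f \<in> borel_measurable M" "g \<in> borel_measurable M"
    and f: "integrable M (\<lambda>x. (f x)\<^sup>2)" and g: "integrable M (\<lambda>x. (g x)\<^sup>2)"
  shows "integrable M (\<lambda>x. f x * g x)"
proof (rule Bochner_Integration.integrable_bound[OF Bochner_Integration.integrable_add[OF f g]])
  have "\<bar>a * b\<bar> \<le> \<bar>a\<^sup>2 + b\<^sup>2\<bar>" for a b :: real
  proof -
    have "0 \<le> (\<bar>a\<bar> - \<bar>b\<bar>)\<^sup>2" by simp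
    then have "2 * (\<bar>a\<bar> * \<bar>b\<bar>) \<le> a\<^sup>2 + b\<^sup>2" by (simp add: power2_diff)
    moreover have "0 \<le> \<bar>a\<bar> * \<bar>b\<bar>" by simp
    ultimately show ?thesis unfolding abs_mult by linarith
  qed
  then show "AE x in M. norm (f x * g x) \<le> norm ((f x)\<^sup>2 + (g x)\<^sup>2)" by simp
qed measurable

text \<open>A conditional Cauchy--Schwarz inequality, from the nonnegativity of the conditional expectation of \<open>(f + c g)\<^sup>2\<close> simultaneously for all rational \<open>c\<close>.\<close>

lemma (in sigma_finite_subalgebra) square_cond_exp_mult_le:
  fixes f g :: "'a \<Rightarrow> real"
  assumes [measurable]: "f \<in> borel_measurable M" "g \<in> borel_measurable M"
    and f: "integrable M (\<lambda>x. (f x)\<^sup>2)" and g: "integrable M (\<lambda>x. (g x)\<^sup>2)"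
    and D: "AE x in M. real_cond_exp M F (\<lambda>x. (g x)\<^sup>2) x \<le> D" and "0 < D"
  shows "AE x in M. (real_cond_exp M F (\<lambda>x. f x * g x) x)\<^sup>2 \<le> D * real_cond_exp M F (\<lambda>x. (f x)\<^sup>2) x"
proof -
  have fg: "integrable M (\<lambda>x. f x * g x)"
    by (rule integrable_mult_of_squares) (use f g in auto)
  let ?E = "real_cond_exp M F"
  have quad: "AE x in M. 0 \<le> ?E (\<lambda>x. (f x)\<^sup>2) x + 2 * c * ?E (\<lambda>x. f x * g x) x + c\<^sup>2 * ?E (\<lambda>x. (g x)\<^sup>2) x"
    for c :: real
  proof -
    have eq: "(\<lambda>x. (f x + c * g x)\<^sup>2) = (\<lambda>x. ((f x)\<^sup>2 + (2 * c) * (f x * g x)) + c\<^sup>2 * (g x)\<^sup>2)"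
      by (auto simp: power2_eq_square algebra_simps)
    have "AE x in M. 0 \<le> ?E (\<lambda>x. (f x + c * g x)\<^sup>2) x"
      by (rule real_cond_exp_pos) auto
    moreover have "AE x in M. ?E (\<lambda>x. ((f x)\<^sup>2 + (2 * c) * (f x * g x)) + c\<^sup>2 * (g x)\<^sup>2) x
        = ?E (\<lambda>x. (f x)\<^sup>2 + (2 * c) * (f x * g x)) x + ?E (\<lambda>x. c\<^sup>2 * (g x)\<^sup>2) x"
      by (rule real_cond_exp_add) (use f g fg in auto)
    moreover have "AE x in M. ?E (\<lambda>x. (f x)\<^sup>2 + (2 * c) * (f x * g x)) x
        = ?E (\<lambda>x. (f x)\<^sup>2) x + ?E (\<lambda>x. (2 * c) * (f x * g x)) x"
      by (rule real_cond_exp_add) (use f g fg in auto)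
    moreover have "AE x in M. ?E (\<lambda>x. (2 * c) * (f x * g x)) x = (2 * c) * ?E (\<lambda>x. f x * g x) x"
      by (rule real_cond_exp_cmult) (use fg in auto)
    moreover have "AE x in M. ?E (\<lambda>x. c\<^sup>2 * (g x)\<^sup>2) x = c\<^sup>2 * ?E (\<lambda>x. (g x)\<^sup>2) x"
      by (rule real_cond_exp_cmult) (use g in auto)
    ultimately show ?thesis unfolding eq by eventually_elim simp
  qed
  have "AE x in M. \<forall>c::rat. 0 \<le> ?E (\<lambda>x. (f x)\<^sup>2) x + 2 * of_rat c * ?E (\<lambda>x. f x * g x) x
      + (of_rat c)\<^sup>2 * ?E (\<lambda>x. (g x)\<^sup>2) x"
    using quad by (subst AE_all_countable) auto
  with D show ?thesis
  proof eventually_elim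
    fix x
    define a where "a = ?E (\<lambda>x. (f x)\<^sup>2) x"
    define b where "b = ?E (\<lambda>x. f x * g x) x"
    define d where "d = ?E (\<lambda>x. (g x)\<^sup>2) x"
    assume "?E (\<lambda>x. (g x)\<^sup>2) x \<le> D"
      and "\<forall>c::rat. 0 \<le> ?E (\<lambda>x. (f x)\<^sup>2) x + 2 * of_rat c * ?E (\<lambda>x. f x * g x) x
        + (of_rat c)\<^sup>2 * ?E (\<lambda>x. (g x)\<^sup>2) x"
    then have dD: "d \<le> D" and q: "\<And>c::rat. 0 \<le> a + 2 * of_rat c * b + (of_rat c)\<^sup>2 * d"
      by (auto simp: a_def b_def d_def)
    \<comment> \<open>The quadratic with \<open>D\<close> in place of \<open>d\<close> has the
      minimiser \<open>- b / D\<close>, which exists even if \<open>d\<close> vanishes. It depends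
      on \<open>x\<close> and may be irrational, hence the extension from the rationals by
      closedness.\<close>
    have q': "0 \<le> a + 2 * c * b + c\<^sup>2 * D" if "c \<in> \<rat>" for c :: real
    proof -
      from that obtain r where "c = of_rat r" by (auto elim: Rats_cases)
      with q[of r] mult_left_mono[OF dD, of "c\<^sup>2"] show ?thesis by simp
    qed
    have "closed {c::real. 0 \<le> a + 2 * c * b + c\<^sup>2 * D}"
      by (intro closed_Collect_le continuous_intros)
    moreover have "\<rat> \<subseteq> {c::real. 0 \<le> a + 2 * c * b + c\<^sup>2 * D}" using q' by auto
    ultimately have "closure \<rat> \<subseteq> {c::real. 0 \<le> a + 2 * c * b + c\<^sup>2 * D}"
      by (rule closure_minimal[rotated])
    moreover have "closure (\<rat> :: real set) = UNIV"
      by (rule Rats_closure_real)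
    ultimately have "0 \<le> a + 2 * (- b / D) * b + (- b / D)\<^sup>2 * D" by blast
    also have "\<dots> = a - b\<^sup>2 / D" using \<open>0 < D\<close> by (simp add: field_simps power2_eq_square)
    finally have "b\<^sup>2 \<le> D * a" using \<open>0 < D\<close> by (simp add: field_simps)
    then show "(?E (\<lambda>x. f x * g x) x)\<^sup>2 \<le> D * ?E (\<lambda>x. (f x)\<^sup>2) x" by (simp add: a_def b_def)
  qed
qed

lemma (in sigma_finite_subalgebra) integrable_square_cond_exp:
  assumes "integrable M f" "integrable M (\<lambda>x. (f x)\<^sup>2)" and "emeasure M (space M) \<noteq> \<infinity>"
  shows "integrable M (\<lambda>x. (real_cond_exp M F f x)\<^sup>2)"
  by (rule integrable_convex_cond_exp[where I = UNIV and q = "\<lambda>x. x\<^sup>2"])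
    (use assms convex_power2 in \<open>auto\<close>)

section \<open>Square-integrable processes driven by the noise\<close>

lemma borel_measurable_vec_iff:
  fixes X :: "'a \<Rightarrow> real^'r::finite"
  shows "X \<in> borel_measurable F \<longleftrightarrow> (\<forall>i. (\<lambda>\<omega>. X \<omega> $ i) \<in> borel_measurable F)"
  by (subst borel_measurable_euclidean_space) (auto simp: Basis_vec_def inner_axis)

lemma borel_measurable_matrix_vector_mult [measurable (raw)]:
  fixes X :: "'a \<Rightarrow> real^'r::finite" and P :: "real^'r^'s::finite"
  assumes "X \<in> borel_measurable F"
  shows "(\<lambda>\<omega>. P *v X \<omega>) \<in> borel_measurable F"
proof -
  have "(\<lambda>x. P *v x) \<in> borel_measurable borel"
    by (intro borel_measurable_continuous_onI linear_continuous_on) (simp add: matrix_vector_mul_bounded_linear)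
  from measurable_compose[OF assms this] show ?thesis by simp
qed

lemma inner_transpose_matrix_vector:
  fixes P :: "real^'r::finite^'s::finite"
  shows "x \<bullet> (transpose P *v y) = (P *v x) \<bullet> y"
  by (metis dot_lmul_matrix inner_commute vector_transpose_matrix transpose_transpose)

locale square_integrable_noise = prob_space M for M :: "'a measure" +
  fixes w :: "nat \<Rightarrow> 'a \<Rightarrow> real^'p::finite" and N :: nat and \<Delta> :: "nat \<Rightarrow> real^'p^'p"
  assumes w_measurable: "k < N \<Longrightarrow> w k \<in> borel_measurable M"
    and w_square_integrable: "k < N \<Longrightarrow> integrable M (\<lambda>\<omega>. (norm (w k \<omega>))\<^sup>2)"
    and w_covariance: "k < N \<Longrightarrow>
      AE \<omega> in M. (\<chi> i j. real_cond_exp M (Fk M w k) (\<lambda>\<eta>. w k \<eta> $ i * w k \<eta> $ j) \<omega>) = \<Delta> k"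
begin

abbreviation F :: "nat \<Rightarrow> 'a measure" where "F k \<equiv> Fk M w k"
abbreviation E :: "nat \<Rightarrow> ('a \<Rightarrow> real^'r::finite) \<Rightarrow> 'a \<Rightarrow> real^'r" where "E k X \<equiv> CEv M (Fk M w k) X"

section \<open>The filtration generated by the noise\<close>

lemma space_F [simp]: "space (F k) = space M"
  by (simp add: Fk_def space_measure_of_conv)

lemma sets_F: "sets (F k) = sigma_sets (space M) {w j -` B \<inter> space M | j B. j < k \<and> B \<in> sets borel}"
  unfolding Fk_def by (rule sets_measure_of) auto

lemma sets_F_mono: "k \<le> l \<Longrightarrow> sets (F k) \<subseteq> sets (F l)"
  unfolding sets_F by (rule sigma_sets_mono') fastforce

lemma sets_F_subset: "k \<le> N \<Longrightarrow> sets (F k) \<subseteq> sets M"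
  unfolding sets_F by (rule sets.sigma_sets_subset) (auto intro: measurable_sets[OF w_measurable])

lemma subalgebra_F: "k \<le> N \<Longrightarrow> subalgebra M (F k)"
  by (simp add: subalgebra_def sets_F_subset)

lemma subalgebra_F_mono: "k \<le> l \<Longrightarrow> subalgebra (F l) (F k)"
  by (simp add: subalgebra_def sets_F_mono)

lemma sigma_finite_subalgebra_F: "k \<le> N \<Longrightarrow> sigma_finite_subalgebra M (F k)"
  by (intro finite_measure_subalgebra_is_sigma_finite
      finite_measure_subalgebra.intro finite_measure_subalgebra_axioms.intro subalgebra_F)
    (rule finite_measure_axioms)

lemma w_F_measurable: "l < k \<Longrightarrow> w l \<in> borel_measurable (F k)"
  by (rule measurableI) (auto simp: sets_F intro!: sigma_sets.Basic)

lemma w_nth_F_measurable: "l < k \<Longrightarrow> (\<lambda>\<omega>. w l \<omega> $ i) \<in> borel_measurable (F k)"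
  using w_F_measurable borel_measurable_vec_iff by blast

lemma w_nth_square_integrable:
  assumes "k < N" shows "integrable M (\<lambda>\<omega>. (w k \<omega> $ i)\<^sup>2)"
proof (rule Bochner_Integration.integrable_bound[OF w_square_integrable[OF assms]])
  show "(\<lambda>\<omega>. (w k \<omega> $ i)\<^sup>2) \<in> borel_measurable M"
    using w_measurable[OF assms] borel_measurable_vec_iff[of "w k"] by (auto intro: borel_measurable_power)
  show "AE \<omega> in M. norm ((w k \<omega> $ i)\<^sup>2) \<le> norm ((norm (w k \<omega>))\<^sup>2)"
    using component_le_norm_cart[of "w k _" i] by (auto intro!: AE_I2 simp: abs_le_square_iff[symmetric])
qed

lemma w_nth_cond_second_moment:
  assumes "k < N"
  shows "AE \<omega> in M. real_cond_exp M (F k) (\<lambda>\<eta>. (w k \<eta> $ i)\<^sup>2) \<omega> = \<Delta> k $ i $ i"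
  using w_covariance[OF assms]
  by eventually_elim (auto simp: vec_eq_iff power2_eq_square)

section \<open>Closure properties of adapted square-integrable vectors\<close>

lemma L2F_iff:
  "L2F M w k X \<longleftrightarrow> (\<forall>i. (\<lambda>\<omega>. X \<omega> $ i) \<in> borel_measurable (F k) \<and> integrable M (\<lambda>\<omega>. (X \<omega> $ i)\<^sup>2))"
  if "k \<le> N" for X :: "'a \<Rightarrow> real^'r::finite"
proof -
  have sq: "(norm (X \<omega>))\<^sup>2 = (\<Sum>i\<in>UNIV. (X \<omega> $ i)\<^sup>2)" for \<omega>
    by (simp add: norm_vec_def L2_set_def sum_nonneg)
  have le: "(X \<omega> $ i)\<^sup>2 \<le> (norm (X \<omega>))\<^sup>2" for \<omega> i
    using component_le_norm_cart[of "X \<omega>" i] by (auto simp: abs_le_square_iff[symmetric])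
  show ?thesis
  proof
    assume X: "L2F M w k X"
    show "\<forall>i. (\<lambda>\<omega>. X \<omega> $ i) \<in> borel_measurable (F k) \<and> integrable M (\<lambda>\<omega>. (X \<omega> $ i)\<^sup>2)"
    proof (intro allI conjI)
      fix i
      show m: "(\<lambda>\<omega>. X \<omega> $ i) \<in> borel_measurable (F k)"
        using X borel_measurable_vec_iff unfolding L2F_def by blast
      show "integrable M (\<lambda>\<omega>. (X \<omega> $ i)\<^sup>2)"
      proof (rule Bochner_Integration.integrable_bound)
        show "integrable M (\<lambda>\<omega>. (norm (X \<omega>))\<^sup>2)" using X by (simp add: L2F_def)
        show "(\<lambda>\<omega>. (X \<omega> $ i)\<^sup>2) \<in> borel_measurable M"
          by (intro borel_measurable_power measurable_from_subalg[OF subalgebra_F[OF that]] m)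
      qed (use le in auto)
    qed
  next
    assume "\<forall>i. (\<lambda>\<omega>. X \<omega> $ i) \<in> borel_measurable (F k) \<and> integrable M (\<lambda>\<omega>. (X \<omega> $ i)\<^sup>2)"
    then show "L2F M w k X"
      unfolding L2F_def sq borel_measurable_vec_iff[of X] by auto
  qed
qed

lemma L2F_mono: "L2F M w k X \<Longrightarrow> k \<le> l \<Longrightarrow> L2F M w l X"
  unfolding L2F_def using measurable_from_subalg[OF subalgebra_F_mono] by blast

lemma L2F_measurable: "L2F M w k X \<Longrightarrow> X \<in> borel_measurable (F k)"
  by (simp add: L2F_def)

lemma L2F_borel: "L2F M w k X \<Longrightarrow> k \<le> N \<Longrightarrow> X \<in> borel_measurable M"
  using L2F_measurable measurable_from_subalg[OF subalgebra_F] by blast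

lemma L2F_nth_borel: "L2F M w k X \<Longrightarrow> k \<le> N \<Longrightarrow> (\<lambda>\<omega>. X \<omega> $ i) \<in> borel_measurable M"
  using L2F_borel borel_measurable_vec_iff by blast

lemma L2F_nth_mult_integrable:
  assumes "L2F M w N X" "L2F M w N Y"
  shows "integrable M (\<lambda>\<omega>. X \<omega> $ i * Y \<omega> $ j)"
  using assms L2F_nth_borel[OF assms(1)] L2F_nth_borel[OF assms(2)]
  by (intro integrable_mult_of_squares) (auto simp: L2F_iff)

lemma L2F_inner_integrable:
  assumes "L2F M w N X" "L2F M w N Y"
  shows "integrable M (\<lambda>\<omega>. X \<omega> \<bullet> Y \<omega>)"
  unfolding inner_vec_def using L2F_nth_mult_integrable[OF assms] by simp

lemma L2F_const [simp]: "L2F M w k (\<lambda>_. c)"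
  by (simp add: L2F_def)

lemma L2F_nth_integrable:
  assumes "L2F M w N X" shows "integrable M (\<lambda>\<omega>. X \<omega> $ i)"
  using L2F_nth_mult_integrable[OF assms, of "\<lambda>_. \<chi> i. 1", of i i] by simp

lemma L2F_add:
  fixes X Y :: "'a \<Rightarrow> real^'r::finite"
  assumes X: "L2F M w k X" and Y: "L2F M w k Y" and k: "k \<le> N"
  shows "L2F M w k (\<lambda>\<omega>. X \<omega> + Y \<omega>)"
  unfolding L2F_iff[OF k]
proof (intro allI conjI)
  fix i
  note X' = X[unfolded L2F_iff[OF k], rule_format, of i] and Y' = Y[unfolded L2F_iff[OF k], rule_format, of i]
  show "(\<lambda>\<omega>. (X \<omega> + Y \<omega>) $ i) \<in> borel_measurable (F k)" using X' Y' by (simp add: borel_measurable_add)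
  have "(\<lambda>\<omega>. ((X \<omega> + Y \<omega>) $ i)\<^sup>2) = (\<lambda>\<omega>. (X \<omega> $ i)\<^sup>2 + 2 * (X \<omega> $ i * Y \<omega> $ i) + (Y \<omega> $ i)\<^sup>2)"
    by (auto simp: power2_eq_square algebra_simps)
  then show "integrable M (\<lambda>\<omega>. ((X \<omega> + Y \<omega>) $ i)\<^sup>2)"
    using X' Y' L2F_nth_mult_integrable[OF L2F_mono[OF X k] L2F_mono[OF Y k], of i i] by simp
qed

lemma L2F_matrix:
  fixes X :: "'a \<Rightarrow> real^'r::finite" and P :: "real^'r^'s::finite"
  assumes X: "L2F M w k X" and k: "k \<le> N"
  shows "L2F M w k (\<lambda>\<omega>. P *v X \<omega>)"
  unfolding L2F_def
proof
  show "(\<lambda>\<omega>. P *v X \<omega>) \<in> borel_measurable (F k)" using L2F_measurable[OF X] by measurable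
  obtain K where K: "\<And>x. norm (P *v x) \<le> norm x * K"
    using bounded_linear.bounded[OF matrix_vector_mul_bounded_linear[of P]] by blast
  show "integrable M (\<lambda>\<omega>. (norm (P *v X \<omega>))\<^sup>2)"
  proof (rule Bochner_Integration.integrable_bound)
    show "integrable M (\<lambda>\<omega>. (norm (X \<omega>))\<^sup>2 * K\<^sup>2)" using X by (simp add: L2F_def)
    show "(\<lambda>\<omega>. (norm (P *v X \<omega>))\<^sup>2) \<in> borel_measurable M" using L2F_borel[OF X k] by measurable
    show "AE \<omega> in M. norm ((norm (P *v X \<omega>))\<^sup>2) \<le> norm ((norm (X \<omega>))\<^sup>2 * K\<^sup>2)"
      using power_mono[OF K norm_ge_zero, where n = 2] by (auto simp: power_mult_distrib)
  qed
qed

lemma L2F_scaleR: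
  assumes X: "L2F M w k X"
  shows "L2F M w k (\<lambda>\<omega>. c *\<^sub>R X \<omega>)"
  using X by (simp add: L2F_def power_mult_distrib borel_measurable_scaleR)

lemma L2F_sum:
  assumes "\<And>i. i \<in> I \<Longrightarrow> L2F M w k (X i)" and k: "k \<le> N"
  shows "L2F M w k (\<lambda>\<omega>. \<Sum>i\<in>I. X i \<omega>)"
  using assms(1) by (induction I rule: infinite_finite_induct) (auto intro: L2F_add k)

text \<open>The squared norm of the product is a product of two functions that are merely
  integrable. It is integrable because the first is measurable at time \<open>l\<close> and the
  second has a constant conditional expectation there.\<close>

lemma L2F_noise:
  fixes X :: "'a \<Rightarrow> real^'r::finite"
  assumes X: "L2F M w l X" and l: "l < N"
  shows "L2F M w (Suc l) (\<lambda>\<omega>. (w l \<omega> $ i) *\<^sub>R X \<omega>)"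
proof -
  interpret sigma_finite_subalgebra M "F l" using l by (intro sigma_finite_subalgebra_F) simp
  have [measurable]: "X \<in> borel_measurable (F (Suc l))" "(\<lambda>\<omega>. w l \<omega> $ i) \<in> borel_measurable (F (Suc l))"
    using L2F_measurable[OF L2F_mono[OF X]] w_nth_F_measurable by auto
  have [measurable]: "X \<in> borel_measurable (F l)" using L2F_measurable[OF X] .
  have "integrable M (\<lambda>\<omega>. (norm (X \<omega>))\<^sup>2 * (w l \<omega> $ i)\<^sup>2)"
  proof (rule integrable_mult_cond_exp_bounded)
    show "AE \<omega> in M. real_cond_exp M (F l) (\<lambda>\<omega>. (w l \<omega> $ i)\<^sup>2) \<omega> \<le> \<Delta> l $ i $ i"
      using w_nth_cond_second_moment[OF l, of i] by eventually_elim simp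
  qed (use X w_nth_square_integrable[OF l] in \<open>auto simp: L2F_def\<close>)
  then show ?thesis by (simp add: L2F_def power_mult_distrib mult.commute)
qed

section \<open>Conditional expectation of random vectors\<close>

lemma E_measurable: "E k X \<in> borel_measurable (F k)"
  unfolding borel_measurable_vec_iff by (simp add: CEv_def)

lemma L2F_E:
  assumes X: "L2F M w N X" and k: "k \<le> N"
  shows "L2F M w k (E k X)"
proof -
  interpret sigma_finite_subalgebra M "F k" by (rule sigma_finite_subalgebra_F[OF k])
  show ?thesis unfolding L2F_iff[OF k] CEv_def
    using X L2F_nth_integrable[OF X] by (auto intro!: integrable_square_cond_exp simp: L2F_iff emeasure_space_1)
qed

lemma E_cong_AE:
  assumes "AE \<omega> in M. X \<omega> = Y \<omega>" "X \<in> borel_measurable M" "Y \<in> borel_measurable M" and k: "k \<le> N"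
  shows "AE \<omega> in M. E k X \<omega> = E k Y \<omega>"
proof -
  interpret sigma_finite_subalgebra M "F k" by (rule sigma_finite_subalgebra_F[OF k])
  have "AE \<omega> in M. \<forall>i. real_cond_exp M (F k) (\<lambda>\<eta>. X \<eta> $ i) \<omega> = real_cond_exp M (F k) (\<lambda>\<eta>. Y \<eta> $ i) \<omega>"
    using assms(1-3) by (subst AE_all_countable, intro allI real_cond_exp_cong) (auto simp: borel_measurable_vec_iff)
  then show ?thesis by eventually_elim (simp add: CEv_def)
qed

lemma E_F_measurable:
  assumes X: "L2F M w k X" and k: "k \<le> N"
  shows "AE \<omega> in M. E k X \<omega> = X \<omega>"
proof -
  interpret sigma_finite_subalgebra M "F k" by (rule sigma_finite_subalgebra_F[OF k])
  have "AE \<omega> in M. \<forall>i. real_cond_exp M (F k) (\<lambda>\<eta>. X \<eta> $ i) \<omega> = X \<omega> $ i"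
    using X L2F_nth_integrable[OF L2F_mono[OF X k]]
    by (subst AE_all_countable, intro allI real_cond_exp_F_meas) (auto simp: L2F_iff[OF k])
  then show ?thesis by eventually_elim (simp add: CEv_def)
qed

lemma E_add:
  assumes X: "L2F M w N X" and Y: "L2F M w N Y" and k: "k \<le> N"
  shows "AE \<omega> in M. E k (\<lambda>\<eta>. X \<eta> + Y \<eta>) \<omega> = E k X \<omega> + E k Y \<omega>"
proof -
  interpret sigma_finite_subalgebra M "F k" by (rule sigma_finite_subalgebra_F[OF k])
  have "AE \<omega> in M. \<forall>i. real_cond_exp M (F k) (\<lambda>\<eta>. X \<eta> $ i + Y \<eta> $ i) \<omega> =
      real_cond_exp M (F k) (\<lambda>\<eta>. X \<eta> $ i) \<omega> + real_cond_exp M (F k) (\<lambda>\<eta>. Y \<eta> $ i) \<omega>"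
    using L2F_nth_integrable[OF X] L2F_nth_integrable[OF Y]
    by (subst AE_all_countable, intro allI real_cond_exp_add) auto
  then show ?thesis by eventually_elim (simp add: CEv_def vec_eq_iff)
qed

lemma E_matrix:
  fixes P :: "real^'r::finite^'s::finite"
  assumes X: "L2F M w N X" and k: "k \<le> N"
  shows "AE \<omega> in M. E k (\<lambda>\<eta>. P *v X \<eta>) \<omega> = P *v E k X \<omega>"
proof -
  interpret sigma_finite_subalgebra M "F k" by (rule sigma_finite_subalgebra_F[OF k])
  have "AE \<omega> in M. \<forall>i. real_cond_exp M (F k) (\<lambda>\<eta>. \<Sum>j\<in>UNIV. P $ i $ j * X \<eta> $ j) \<omega> =
      (\<Sum>j\<in>UNIV. real_cond_exp M (F k) (\<lambda>\<eta>. P $ i $ j * X \<eta> $ j) \<omega>)"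
    using L2F_nth_integrable[OF X]
    by (subst AE_all_countable, intro allI real_cond_exp_sum) auto
  moreover have "AE \<omega> in M. \<forall>i j. real_cond_exp M (F k) (\<lambda>\<eta>. P $ i $ j * X \<eta> $ j) \<omega> =
       P $ i $ j * real_cond_exp M (F k) (\<lambda>\<eta>. X \<eta> $ j) \<omega>"
    using L2F_nth_integrable[OF X] by (simp add: AE_all_countable)
  ultimately show ?thesis
    by eventually_elim (simp add: CEv_def vec_eq_iff matrix_vector_mult_def)
qed

lemma E_scaleR:
  assumes X: "L2F M w N X" and k: "k \<le> N"
  shows "AE \<omega> in M. E k (\<lambda>\<eta>. c *\<^sub>R X \<eta>) \<omega> = c *\<^sub>R E k X \<omega>"
proof -
  interpret sigma_finite_subalgebra M "F k" by (rule sigma_finite_subalgebra_F[OF k])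
  have "AE \<omega> in M. \<forall>j. real_cond_exp M (F k) (\<lambda>\<eta>. c * X \<eta> $ j) \<omega> =
       c * real_cond_exp M (F k) (\<lambda>\<eta>. X \<eta> $ j) \<omega>"
    using L2F_nth_integrable[OF X] by (simp add: AE_all_countable)
  then show ?thesis
    by eventually_elim (simp add: CEv_def vec_eq_iff)
qed

text \<open>\<open>Y\<close> may depend on \<open>w l\<close>, so the product itself need not be
  square integrable. Conditional Cauchy-Schwarz bounds the square of its conditional expectation by
  a constant times the conditional second moment of \<open>Y\<close>.\<close>

lemma L2F_E_noise:
  fixes Y :: "'a \<Rightarrow> real^'r::finite"
  assumes Y: "L2F M w N Y" and l: "l < N"
  shows "L2F M w l (E l (\<lambda>\<eta>. (w l \<eta> $ i) *\<^sub>R Y \<eta>))"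
proof -
  have l': "l \<le> N" using l by simp
  interpret sigma_finite_subalgebra M "F l" by (rule sigma_finite_subalgebra_F[OF l'])
  show ?thesis unfolding L2F_iff[OF l']
  proof (intro allI conjI)
    fix j
    have [measurable]: "(\<lambda>\<omega>. Y \<omega> $ j) \<in> borel_measurable M" "(\<lambda>\<omega>. w l \<omega> $ i) \<in> borel_measurable M"
      using L2F_nth_borel[OF Y] w_measurable[OF l] by (auto simp: borel_measurable_vec_iff)
    \<comment> \<open>The summand 1 makes the bound strictly positive, as Cauchy-Schwarz requires,
      even for a degenerate covariance.\<close>
    let ?D = "\<bar>\<Delta> l $ i $ i\<bar> + 1"
    have Yj: "integrable M (\<lambda>\<omega>. (Y \<omega> $ j)\<^sup>2)" using Y by (simp add: L2F_iff)
    have "AE \<omega> in M. (real_cond_exp M (F l) (\<lambda>\<omega>. Y \<omega> $ j * w l \<omega> $ i) \<omega>)\<^sup>2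
        \<le> ?D * real_cond_exp M (F l) (\<lambda>\<omega>. (Y \<omega> $ j)\<^sup>2) \<omega>"
    proof (rule square_cond_exp_mult_le)
      show "AE \<omega> in M. real_cond_exp M (F l) (\<lambda>\<omega>. (w l \<omega> $ i)\<^sup>2) \<omega> \<le> ?D"
        using w_nth_cond_second_moment[OF l, of i] by eventually_elim linarith
    qed (use Yj w_nth_square_integrable[OF l] in auto)
    then have le: "AE \<omega> in M. norm ((E l (\<lambda>\<eta>. w l \<eta> $ i *\<^sub>R Y \<eta>) \<omega> $ j)\<^sup>2)
        \<le> norm (?D * real_cond_exp M (F l) (\<lambda>\<omega>. (Y \<omega> $ j)\<^sup>2) \<omega>)"
      by eventually_elim (simp add: CEv_def mult.commute)
    show "integrable M (\<lambda>\<omega>. (E l (\<lambda>\<eta>. w l \<eta> $ i *\<^sub>R Y \<eta>) \<omega> $ j)\<^sup>2)"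
    proof (rule Bochner_Integration.integrable_bound[OF _ _ le])
      show "integrable M (\<lambda>\<omega>. ?D * real_cond_exp M (F l) (\<lambda>\<omega>. (Y \<omega> $ j)\<^sup>2) \<omega>)"
        using real_cond_exp_int(1)[OF Yj] by simp
    qed (simp add: CEv_def)
  next
    fix j show "(\<lambda>\<omega>. E l (\<lambda>\<eta>. w l \<eta> $ i *\<^sub>R Y \<eta>) \<omega> $ j) \<in> borel_measurable (F l)"
      by (simp add: CEv_def)
  qed
qed

lemma E_tower_noise:
  fixes Y :: "'a \<Rightarrow> real^'r::finite"
  assumes Y: "L2F M w N Y" and l: "l < N" and k: "k \<le> l"
  shows "AE \<omega> in M. E k (E l (\<lambda>\<eta>. (w l \<eta> $ i) *\<^sub>R Y \<eta>)) \<omega> = E k (\<lambda>\<eta>. (w l \<eta> $ i) *\<^sub>R Y \<eta>) \<omega>"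
proof -
  interpret sigma_finite_subalgebra M "F k" using k l by (intro sigma_finite_subalgebra_F) auto
  have int: "integrable M (\<lambda>\<eta>. w l \<eta> $ i * Y \<eta> $ j)" for j
    using L2F_nth_borel[OF Y] w_measurable[OF l] Y w_nth_square_integrable[OF l]
    by (intro integrable_mult_of_squares) (auto simp: borel_measurable_vec_iff L2F_iff)
  have "AE \<omega> in M. \<forall>j. real_cond_exp M (F k) (real_cond_exp M (F l) (\<lambda>\<eta>. w l \<eta> $ i * Y \<eta> $ j)) \<omega> =
      real_cond_exp M (F k) (\<lambda>\<eta>. w l \<eta> $ i * Y \<eta> $ j) \<omega>"
    using l k int by (subst AE_all_countable, intro allI real_cond_exp_nested_subalg)
      (auto intro: subalgebra_F subalgebra_F_mono)
  then show ?thesis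
    by eventually_elim (simp add: CEv_def vec_eq_iff)
qed

text \<open>The covariance hypothesis on \<open>w l\<close> is conditional on \<open>F l\<close>.
  The estimate is therefore made at time \<open>l\<close> and carried down to \<open>k\<close> by
  the tower property, which holds almost surely only and so requires measurability to be shown
  separately.\<close>

lemma L2F_E_noise_le:
  fixes Y :: "'a \<Rightarrow> real^'r::finite"
  assumes Y: "L2F M w N Y" and l: "l < N" and k: "k \<le> l"
  shows "L2F M w k (E k (\<lambda>\<eta>. (w l \<eta> $ i) *\<^sub>R Y \<eta>))"
proof -
  let ?Z = "E k (E l (\<lambda>\<eta>. (w l \<eta> $ i) *\<^sub>R Y \<eta>))"
  let ?W = "E k (\<lambda>\<eta>. (w l \<eta> $ i) *\<^sub>R Y \<eta>)"
  have kN: "k \<le> N" using k l by simp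
  have Z: "L2F M w k ?Z" using l by (intro L2F_E[OF L2F_mono[OF L2F_E_noise[OF Y l]] kN]) simp
  have W: "?W \<in> borel_measurable (F k)" by (rule E_measurable)
  have "integrable M (\<lambda>\<omega>. (norm (?Z \<omega>))\<^sup>2)" using Z by (simp add: L2F_def)
  moreover have [measurable]: "?Z \<in> borel_measurable M" "?W \<in> borel_measurable M"
    using L2F_borel[OF Z kN] measurable_from_subalg[OF subalgebra_F[OF kN] W] .
  moreover have "AE \<omega> in M. (norm (?Z \<omega>))\<^sup>2 = (norm (?W \<omega>))\<^sup>2"
    using E_tower_noise[OF Y l k, of i] by eventually_elim simp
  ultimately have "integrable M (\<lambda>\<omega>. (norm (?W \<omega>))\<^sup>2)"
    using integrable_cong_AE_imp[of M "\<lambda>\<omega>. (norm (?Z \<omega>))\<^sup>2" "\<lambda>\<omega>. (norm (?W \<omega>))\<^sup>2"] by simp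
  with W show ?thesis by (simp add: L2F_def)
qed

section \<open>The bilinear form over an event and its adjoints\<close>

text \<open>As A ranges over \<open>F k\<close>, these numbers determine the conditional expectation
  at time k of the inner product; almost sure identities thereby become identities between
  reals.\<close>

definition ip :: "'a set \<Rightarrow> ('a \<Rightarrow> real^'r::finite) \<Rightarrow> ('a \<Rightarrow> real^'r) \<Rightarrow> real" where
  "ip A X Y = (\<integral>\<omega>. indicator A \<omega> * (X \<omega> \<bullet> Y \<omega>) \<partial>M)"

lemma ip_commute: "ip A X Y = ip A Y X"
  by (simp add: ip_def inner_commute)

lemma ip_integrable:
  assumes "L2F M w N X" "L2F M w N Y" "A \<in> sets M"
  shows "integrable M (\<lambda>\<omega>. indicator A \<omega> * (X \<omega> \<bullet> Y \<omega>))"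
  using integrable_mult_indicator[OF assms(3) L2F_inner_integrable[OF assms(1,2)]] by simp

lemma ip_add_left:
  assumes "L2F M w N X" "L2F M w N Y" "L2F M w N Z" "A \<in> sets M"
  shows "ip A (\<lambda>\<omega>. X \<omega> + Y \<omega>) Z = ip A X Z + ip A Y Z"
  using ip_integrable[of X Z A] ip_integrable[of Y Z A] assms
  by (simp add: ip_def inner_add_left distrib_left)

lemma ip_add_right:
  assumes "L2F M w N X" "L2F M w N Y" "L2F M w N Z" "A \<in> sets M"
  shows "ip A Z (\<lambda>\<omega>. X \<omega> + Y \<omega>) = ip A Z X + ip A Z Y"
  using ip_add_left[OF assms] by (simp add: ip_commute)

lemma ip_zero_left [simp]: "ip A (\<lambda>_. 0) Z = 0"
  by (simp add: ip_def)

lemma ip_sum_left: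
  assumes "\<And>i. i \<in> I \<Longrightarrow> L2F M w N (X i)" "L2F M w N Z" "A \<in> sets M"
  shows "ip A (\<lambda>\<omega>. \<Sum>i\<in>I. X i \<omega>) Z = (\<Sum>i\<in>I. ip A (X i) Z)"
  using assms(1)
  by (induction I rule: infinite_finite_induct) (auto simp: ip_add_left assms(2,3) L2F_sum)

lemma ip_sum_right:
  assumes "\<And>i. i \<in> I \<Longrightarrow> L2F M w N (X i)" "L2F M w N Z" "A \<in> sets M"
  shows "ip A Z (\<lambda>\<omega>. \<Sum>i\<in>I. X i \<omega>) = (\<Sum>i\<in>I. ip A Z (X i))"
  using ip_sum_left[OF assms] by (simp add: ip_commute)

lemma ip_transpose: "ip A X (\<lambda>\<omega>. transpose P *v Y \<omega>) = ip A (\<lambda>\<omega>. P *v X \<omega>) Y"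
  unfolding ip_def inner_transpose_matrix_vector ..

lemma ip_scaleR_left: "ip A (\<lambda>\<omega>. f \<omega> *\<^sub>R X \<omega>) Y = ip A X (\<lambda>\<omega>. f \<omega> *\<^sub>R Y \<omega>)"
  by (simp add: ip_def)

lemma ip_cong_AE:
  assumes "AE \<omega> in M. X \<omega> = X' \<omega>" "AE \<omega> in M. Y \<omega> = Y' \<omega>"
    and [measurable]: "X \<in> borel_measurable M" "X' \<in> borel_measurable M"
      "Y \<in> borel_measurable M" "Y' \<in> borel_measurable M" "A \<in> sets M"
  shows "ip A X Y = ip A X' Y'"
  unfolding ip_def
proof (rule integral_cong_AE)
  show "AE \<omega> in M. indicat_real A \<omega> * (X \<omega> \<bullet> Y \<omega>) = indicat_real A \<omega> * (X' \<omega> \<bullet> Y' \<omega>)"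
    using assms(1,2) by eventually_elim simp
qed measurable

text \<open>The indicator of A is absorbed into \<open>X\<close>, which stays measurable at time
  \<open>l\<close> since \<open>F k\<close> is contained in \<open>F l\<close>. Only the coordinate
  products are assumed integrable, because \<open>Z\<close> will be a noise product that need not be
  square integrable.\<close>

lemma ip_E_of_integrable:
  fixes X Z :: "'a \<Rightarrow> real^'r::finite"
  assumes X: "X \<in> borel_measurable (F l)" and Z: "Z \<in> borel_measurable M"
    and int: "\<And>i. integrable M (\<lambda>\<omega>. X \<omega> $ i * Z \<omega> $ i)"
    and A: "A \<in> sets (F k)" and k: "k \<le> l" "l \<le> N"
  shows "ip A X (E l Z) = ip A X Z"
proof -
  interpret sigma_finite_subalgebra M "F l" by (rule sigma_finite_subalgebra_F[OF k(2)])
  have [measurable]: "A \<in> sets (F l)" using A sets_F_mono[OF k(1)] by auto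
  then have AM: "A \<in> sets M" using sets_F_subset[OF k(2)] by auto
  have [measurable]: "(\<lambda>\<omega>. X \<omega> $ i) \<in> borel_measurable (F l)" "(\<lambda>\<omega>. Z \<omega> $ i) \<in> borel_measurable M" for i
    using X Z borel_measurable_vec_iff by blast+
  have int': "integrable M (\<lambda>\<omega>. (indicator A \<omega> * X \<omega> $ i) * Z \<omega> $ i)" for i
    using integrable_mult_indicator[OF AM int[of i]] by (simp add: mult.assoc)
  have *: "integrable M (\<lambda>\<omega>. (indicator A \<omega> * X \<omega> $ i) * real_cond_exp M (F l) (\<lambda>\<omega>. Z \<omega> $ i) \<omega>)"
     "(\<integral>\<omega>. (indicator A \<omega> * X \<omega> $ i) * real_cond_exp M (F l) (\<lambda>\<omega>. Z \<omega> $ i) \<omega> \<partial>M)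
      = (\<integral>\<omega>. (indicator A \<omega> * X \<omega> $ i) * Z \<omega> $ i \<partial>M)" for i
    by (intro real_cond_exp_intg int'; measurable)+
  show ?thesis
    using * int' by (simp add: ip_def inner_vec_def CEv_def sum_distrib_left mult.assoc
        del: Bochner_Integration.sum_indicator_mult Indicator_Function.sum_indicator_mult)
qed

lemma ip_E_right:
  assumes "L2F M w l X" "L2F M w N Y" "A \<in> sets (F k)" "k \<le> l" "l \<le> N"
  shows "ip A X (E l Y) = ip A X Y"
  using assms
  by (intro ip_E_of_integrable[of X l Y A k] L2F_nth_mult_integrable L2F_measurable
      L2F_borel[where k = N]) (auto intro: L2F_mono)

text \<open>The noise factor moves from \<open>Y\<close>, where it may destroy square integrability,
  to the adapted \<open>X\<close>, where \<open>L2F_noise\<close> preserves it; this also supplies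
  the integrability needed to drop \<open>E l\<close>.\<close>

lemma ip_E_noise_right:
  assumes X: "L2F M w l X" and Y: "L2F M w N Y" and A: "A \<in> sets (F k)" and k: "k \<le> l" "l \<le> j" "j < N"
  shows "ip A X (E l (\<lambda>\<eta>. (w j \<eta> $ i) *\<^sub>R Y \<eta>)) = ip A (\<lambda>\<omega>. (w j \<omega> $ i) *\<^sub>R X \<omega>) Y"
proof -
  have XN: "L2F M w N (\<lambda>\<omega>. (w j \<omega> $ i) *\<^sub>R X \<omega>)"
    using L2F_mono[OF L2F_noise[OF L2F_mono[OF X k(2)] k(3)]] k by simp
  have [measurable]: "Y \<in> borel_measurable M" "(\<lambda>\<omega>. w j \<omega> $ i) \<in> borel_measurable M"
    using L2F_borel[OF Y] w_measurable[OF k(3)] borel_measurable_vec_iff[of "w j"] by auto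
  have "ip A X (E l (\<lambda>\<eta>. (w j \<eta> $ i) *\<^sub>R Y \<eta>)) = ip A X (\<lambda>\<eta>. (w j \<eta> $ i) *\<^sub>R Y \<eta>)"
    using L2F_nth_mult_integrable[OF XN Y] k
    by (intro ip_E_of_integrable[of X l _ A k] L2F_measurable[OF X] A) (auto simp: ac_simps)
  then show ?thesis by (simp add: ip_scaleR_left)
qed

text \<open>Square integrability is asked of \<open>E k Z\<close> and not of \<open>Z\<close>, so
  that noise products are covered.\<close>

lemma ip_E_E:
  assumes X: "L2F M w N X" and Z: "Z \<in> borel_measurable M" and EZ: "L2F M w k (E k Z)"
    and A: "A \<in> sets (F k)" and k: "k \<le> N"
  shows "ip A X (E k Z) = ip A (E k X) (E k Z)"
  using ip_E_right[OF EZ X A order_refl k] by (simp add: ip_commute)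

text \<open>Self-adjointness of \<open>E k\<close>: a mean-field term \<open>E k\<close> of \<alpha>
  in the forward recursion becomes a term \<open>E k\<close> of Y in the backward one.
  \<open>ip_E_noise_swap\<close> does the same for the mean-field part of the diffusion.\<close>

lemma ip_E_swap:
  assumes X: "L2F M w N X" and Y: "L2F M w N Y" and A: "A \<in> sets (F k)" and k: "k \<le> N"
  shows "ip A X (E k Y) = ip A (E k X) Y"
  using ip_E_E[OF X L2F_borel[OF Y order_refl] L2F_E[OF Y k] A k]
    ip_E_right[OF L2F_E[OF X k] Y A order_refl k] by simp

lemma ip_E_noise_swap:
  assumes X: "L2F M w N X" and Y: "L2F M w N Y" and A: "A \<in> sets (F k)" and k: "k \<le> j" "j < N"
  shows "ip A X (E k (\<lambda>\<eta>. (w j \<eta> $ i) *\<^sub>R Y \<eta>)) = ip A (\<lambda>\<omega>. (w j \<omega> $ i) *\<^sub>R E k X \<omega>) Y"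
proof -
  have kN: "k \<le> N" using k by simp
  have [measurable]: "Y \<in> borel_measurable M" "(\<lambda>\<omega>. w j \<omega> $ i) \<in> borel_measurable M"
    using L2F_borel[OF Y] w_measurable[OF k(2)] borel_measurable_vec_iff[of "w j"] by auto
  have "ip A X (E k (\<lambda>\<eta>. (w j \<eta> $ i) *\<^sub>R Y \<eta>)) = ip A (E k X) (E k (\<lambda>\<eta>. (w j \<eta> $ i) *\<^sub>R Y \<eta>))"
    using L2F_E_noise_le[OF Y k(2,1)] kN by (intro ip_E_E X A) auto
  also have "\<dots> = ip A (\<lambda>\<omega>. (w j \<omega> $ i) *\<^sub>R E k X \<omega>) Y"
    by (rule ip_E_noise_right[OF L2F_E[OF X kN] Y A order_refl k])
  finally show ?thesis .
qed

lemma ip_quadratic_add: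
  assumes X: "L2F M w N X" and Y: "L2F M w N Y" and A: "A \<in> sets M" and Q: "transpose Q = Q"
  shows "ip A (\<lambda>\<omega>. X \<omega> + Y \<omega>) (\<lambda>\<omega>. Q *v (X \<omega> + Y \<omega>))
    = ip A X (\<lambda>\<omega>. Q *v X \<omega>) + ip A Y (\<lambda>\<omega>. Q *v Y \<omega>) + 2 * ip A Y (\<lambda>\<omega>. Q *v X \<omega>)"
proof -
  have "ip A X (\<lambda>\<omega>. Q *v Y \<omega>) = ip A Y (\<lambda>\<omega>. Q *v X \<omega>)"
    using ip_transpose[of A X Q Y] Q by (simp add: ip_commute)
  then show ?thesis
    using X Y A by (simp add: matrix_vector_right_distrib ip_add_left ip_add_right L2F_add L2F_matrix)
qed

section \<open>Identifying random variables by their integrals over events\<close>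

text \<open>The integral of a non-integrable function is 0 by convention, so values alone would not
  add up; carrying integrability along lets the integral of a cost be computed by rules that follow
  its syntax.\<close>

definition has_int :: "'a set \<Rightarrow> ('a \<Rightarrow> real) \<Rightarrow> real \<Rightarrow> bool" where
  "has_int A f r \<longleftrightarrow> integrable M f \<and> (\<integral>\<omega>. indicator A \<omega> * f \<omega> \<partial>M) = r"

definition has_F_int :: "nat \<Rightarrow> 'a set \<Rightarrow> ('a \<Rightarrow> real) \<Rightarrow> real \<Rightarrow> bool" where
  "has_F_int k A f r \<longleftrightarrow> f \<in> borel_measurable (F k) \<and> has_int A f r"

lemma integrable_indicator_mult:
  fixes f :: "'a \<Rightarrow> real"
  assumes "integrable M f" "A \<in> sets M"
  shows "integrable M (\<lambda>\<omega>. indicator A \<omega> * f \<omega>)"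
  using integrable_mult_indicator[OF assms(2,1)] by simp

lemma has_int_add:
  assumes "has_int A f r" "has_int A g s" "A \<in> sets M"
  shows "has_int A (\<lambda>\<omega>. f \<omega> + g \<omega>) (r + s)"
  using assms integrable_indicator_mult[of f A] integrable_indicator_mult[of g A]
  by (auto simp: has_int_def distrib_left)

lemma has_int_cmult:
  assumes "has_int A f r"
  shows "has_int A (\<lambda>\<omega>. c * f \<omega>) (c * r)"
proof -
  have "(\<lambda>\<omega>. indicator A \<omega> * (c * f \<omega>)) = (\<lambda>\<omega>. c * (indicator A \<omega> * f \<omega>))" by auto
  with assms show ?thesis by (simp add: has_int_def)
qed

lemma has_int_inner:
  assumes "L2F M w N X" "L2F M w N Y"
  shows "has_int A (\<lambda>\<omega>. X \<omega> \<bullet> Y \<omega>) (ip A X Y)"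
  using L2F_inner_integrable[OF assms] by (simp add: has_int_def ip_def)

lemma has_F_int_add:
  assumes "has_F_int k A f r" "has_F_int k A g s" "A \<in> sets M"
  shows "has_F_int k A (\<lambda>\<omega>. f \<omega> + g \<omega>) (r + s)"
  using assms by (auto simp: has_F_int_def intro: has_int_add borel_measurable_add)

lemma has_F_int_cmult:
  assumes "has_F_int k A f r"
  shows "has_F_int k A (\<lambda>\<omega>. c * f \<omega>) (c * r)"
  using assms by (auto simp: has_F_int_def intro: has_int_cmult)

lemma has_F_int_sum:
  assumes "\<And>i. i \<in> I \<Longrightarrow> has_F_int k A (f i) (r i)" "A \<in> sets M"
  shows "has_F_int k A (\<lambda>\<omega>. \<Sum>i\<in>I. f i \<omega>) (\<Sum>i\<in>I. r i)"
  using assms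
proof (induction I rule: infinite_finite_induct)
  case (insert i I)
  then show ?case using has_F_int_add[of k A "f i" "r i"] by simp
qed (auto simp: has_F_int_def has_int_def)

lemma has_F_int_inner:
  assumes "L2F M w k X" "L2F M w k Y" "k \<le> N"
  shows "has_F_int k A (\<lambda>\<omega>. X \<omega> \<bullet> Y \<omega>) (ip A X Y)"
  unfolding has_F_int_def
  using has_int_inner[OF L2F_mono[OF assms(1,3)] L2F_mono[OF assms(2,3)]] assms(1,2)[THEN L2F_measurable]
  by (auto intro: borel_measurable_inner)

text \<open>Integration over an event of \<open>F k\<close> does not see an outer conditional
  expectation. This removes all the outer ones from the cost, leaving only those inside the
  mean-field terms.\<close>

lemma has_F_int_cond_exp:
  assumes f: "has_int A f r" and k: "k \<le> N" and A: "A \<in> sets (F k)"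
  shows "has_F_int k A (real_cond_exp M (F k) f) r"
proof -
  interpret sigma_finite_subalgebra M "F k" by (rule sigma_finite_subalgebra_F[OF k])
  have fi: "integrable M f" using f by (simp add: has_int_def)
  have "(\<integral>\<omega>. indicator A \<omega> * real_cond_exp M (F k) f \<omega> \<partial>M) = (\<integral>\<omega>. indicator A \<omega> * f \<omega> \<partial>M)"
    using real_cond_exp_intA[OF fi A] by (simp add: set_lebesgue_integral_def)
  with f real_cond_exp_int(1)[OF fi] show ?thesis by (simp add: has_F_int_def has_int_def)
qed

lemma AE_eq_of_F_integrals:
  assumes k: "k \<le> N"
    and f: "\<And>A. A \<in> sets (F k) \<Longrightarrow> has_F_int k A f (r A)"
    and g: "\<And>A. A \<in> sets (F k) \<Longrightarrow> has_F_int k A g (r A)"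
  shows "AE \<omega> in M. f \<omega> = g \<omega>"
proof -
  interpret sigma_finite_subalgebra M "F k" by (rule sigma_finite_subalgebra_F[OF k])
  \<comment> \<open>The empty event serves only to extract measurability and integrability; any
    event of \<open>F k\<close> would do.\<close>
  have fm: "f \<in> borel_measurable (F k)" "integrable M f" and gm: "g \<in> borel_measurable (F k)" "integrable M g"
    using f[of "{}"] g[of "{}"] by (auto simp: has_F_int_def has_int_def)
  have "AE \<omega> in M. real_cond_exp M (F k) f \<omega> = g \<omega>"
  proof (rule real_cond_exp_charact)
    fix A assume A: "A \<in> sets (F k)"
    show "(\<integral>\<omega>\<in>A. f \<omega> \<partial>M) = (\<integral>\<omega>\<in>A. g \<omega> \<partial>M)"
      using f[OF A] g[OF A] by (simp add: has_F_int_def has_int_def set_lebesgue_integral_def)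
  qed (use fm gm in auto)
  moreover have "AE \<omega> in M. real_cond_exp M (F k) f \<omega> = f \<omega>"
    by (rule real_cond_exp_F_meas) (use fm in auto)
  ultimately show ?thesis by eventually_elim simp
qed

text \<open>Conditional expectation is additive only almost surely, so the perturbed states split
  only almost surely; this version of the expansion and the two lemmas that follow accept such
  splittings.\<close>

lemma ip_quadratic_add_AE:
  assumes X: "L2F M w N X" and Y: "L2F M w N Y" and Z: "L2F M w N Z" and A: "A \<in> sets M"
    and Q: "transpose Q = Q" and eq: "AE \<omega> in M. Z \<omega> = X \<omega> + Y \<omega>"
  shows "ip A Z (\<lambda>\<omega>. Q *v Z \<omega>)
    = ip A X (\<lambda>\<omega>. Q *v X \<omega>) + ip A Y (\<lambda>\<omega>. Q *v Y \<omega>) + 2 * ip A Y (\<lambda>\<omega>. Q *v X \<omega>)"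
proof -
  have [measurable]: "X \<in> borel_measurable M" "Y \<in> borel_measurable M" "Z \<in> borel_measurable M"
    using X Y Z by (auto intro: L2F_borel)
  have "ip A Z (\<lambda>\<omega>. Q *v Z \<omega>) = ip A (\<lambda>\<omega>. X \<omega> + Y \<omega>) (\<lambda>\<omega>. Q *v (X \<omega> + Y \<omega>))"
    by (rule ip_cong_AE) (use eq A in \<open>auto elim: eventually_mono\<close>)
  then show ?thesis using ip_quadratic_add[OF X Y A Q] by simp
qed

lemma ip_add_right_AE:
  assumes X: "L2F M w N X" and Y: "L2F M w N Y" and Z: "L2F M w N Z" and C: "L2F M w N C"
    and A: "A \<in> sets M" and eq: "AE \<omega> in M. Z \<omega> = X \<omega> + Y \<omega>"
  shows "ip A C Z = ip A C X + ip A C Y"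
proof -
  have [measurable]: "X \<in> borel_measurable M" "Y \<in> borel_measurable M" "Z \<in> borel_measurable M" "C \<in> borel_measurable M"
    using X Y Z C by (auto intro: L2F_borel)
  have "ip A C Z = ip A C (\<lambda>\<omega>. X \<omega> + Y \<omega>)"
    by (rule ip_cong_AE) (use eq A in \<open>auto\<close>)
  then show ?thesis using ip_add_right[OF X Y C A] by simp
qed

lemma E_add_AE:
  assumes X: "L2F M w N X" and Y: "L2F M w N Y" and Z: "L2F M w N Z" and k: "k \<le> N"
    and eq: "AE \<omega> in M. Z \<omega> = X \<omega> + Y \<omega>"
  shows "AE \<omega> in M. E k Z \<omega> = E k X \<omega> + E k Y \<omega>"
proof -
  have "AE \<omega> in M. E k Z \<omega> = E k (\<lambda>\<omega>. X \<omega> + Y \<omega>) \<omega>"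
    using X Y Z by (intro E_cong_AE eq k) (auto intro: L2F_borel L2F_add)
  with E_add[OF X Y k] show ?thesis by eventually_elim simp
qed

end

section \<open>The recursions in absolute time\<close>

lemma state_init [simp]: "state M w L s \<xi> U s = \<xi>"
  by (simp add: state_def)

lemma state_Suc:
  assumes "s \<le> k"
  shows "state M w L s \<xi> U (Suc k) = (let X = state M w L s \<xi> U k; u = U k X;
          EXs = CEv M (Fk M w s) X; Eu = CEv M (Fk M w s) u
      in (\<lambda>\<omega>. mA L s k *v X \<omega> + mAb L s k *v EXs \<omega> + mB L s k *v u \<omega> + mBb L s k *v Eu \<omega> + vf L s k
          + (\<Sum>i\<in>UNIV. (w k \<omega> $ i) *\<^sub>R
               (mC L i s k *v X \<omega> + mCb L i s k *v EXs \<omega> + mD L i s k *v u \<omega>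
                + mDb L i s k *v Eu \<omega> + vd L i s k))))"
  using assms by (simp add: state_def Suc_diff_le Let_def)

lemma eqst_init [simp]: "eqst w L t x \<Phi> v t = x"
  by (simp add: eqst_def)

lemma eqst_Suc:
  assumes "t \<le> k"
  shows "eqst w L t x \<Phi> v (Suc k) = (\<lambda>\<omega>. (cA L k k + cB L k k ** \<Phi> k) *v eqst w L t x \<Phi> v k \<omega> + cB L k k *v v k \<omega> + vf L k k
         + (\<Sum>i\<in>UNIV. (w k \<omega> $ i) *\<^sub>R
              ((cC L i k k + cD L i k k ** \<Phi> k) *v eqst w L t x \<Phi> v k \<omega> + cD L i k k *v v k \<omega> + vd L i k k)))"
  using assms by (simp add: eqst_def Suc_diff_le Let_def)

lemma alpha_init [simp]: "alpha M w L k \<Phi> ub k = (\<lambda>_. 0)"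
  by (simp add: alpha_def)

lemma alpha_Suc_init:
  "alpha M w L k \<Phi> ub (Suc k) =
     (\<lambda>\<omega>. cB L k k *v ub \<omega> + (\<Sum>i\<in>UNIV. (w k \<omega> $ i) *\<^sub>R (cD L i k k *v ub \<omega>)))"
  by (simp add: alpha_def)

lemma alpha_Suc:
  assumes "k < l"
  shows "alpha M w L k \<Phi> ub (Suc l) = (let a = alpha M w L k \<Phi> ub l; Fkk = Fk M w k in
        (\<lambda>\<omega>. (mA L k l + mB L k l ** \<Phi> l) *v a \<omega> + (mAb L k l + mBb L k l ** \<Phi> l) *v CEv M Fkk a \<omega>
           + (\<Sum>i\<in>UNIV. (w l \<omega> $ i) *\<^sub>R
                ((mC L i k l + mD L i k l ** \<Phi> l) *v a \<omega>
                 + (mCb L i k l + mDb L i k l ** \<Phi> l) *v CEv M Fkk a \<omega>))))"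
  using assms by (simp add: alpha_def Suc_diff_le Let_def)

lemma Yproc_terminal:
  "Yproc M w L N t x \<Phi> v k N = (let X = Xfb M w L t x \<Phi> v k N; Fkk = Fk M w k in
      (\<lambda>\<omega>. mG L k *v X \<omega> + mGb L k *v CEv M Fkk X \<omega> + mF L k *v eqst w L t x \<Phi> v k \<omega> + vg L k))"
  by (simp add: Yproc_def)

lemma Yproc_step:
  assumes "l < N"
  shows "Yproc M w L N t x \<Phi> v k l =
     (let Y' = Yproc M w L N t x \<Phi> v k (Suc l); X = Xfb M w L t x \<Phi> v k l;
          Fkk = Fk M w k; Fl = Fk M w l in
      (\<lambda>\<omega>. (mQ L k l + transpose (\<Phi> l) ** mR L k l ** \<Phi> l) *v X \<omega>
         + (mQb L k l + transpose (\<Phi> l) ** mRb L k l ** \<Phi> l) *v CEv M Fkk X \<omega>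
         + transpose (\<Phi> l) *v (mR L k l *v v l \<omega>)
         + transpose (\<Phi> l) *v (mRb L k l *v CEv M Fkk (v l) \<omega>)
         + transpose (mA L k l + mB L k l ** \<Phi> l) *v CEv M Fl Y' \<omega>
         + transpose (mAb L k l + mBb L k l ** \<Phi> l) *v CEv M Fkk Y' \<omega>
         + (\<Sum>i\<in>UNIV. transpose (mC L i k l + mD L i k l ** \<Phi> l) *v CEv M Fl (\<lambda>\<eta>. (w l \<eta> $ i) *\<^sub>R Y' \<eta>) \<omega>
             + transpose (mCb L i k l + mDb L i k l ** \<Phi> l) *v CEv M Fkk (\<lambda>\<eta>. (w l \<eta> $ i) *\<^sub>R Y' \<eta>) \<omega>)
         + transpose (\<Phi> l) *v vrho L k l + vq L k l))"
proof -
  \<comment> \<open>\<open>YJ\<close> recurses on the remaining time: the step to time l is the one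
    with \<open>j = N - Suc l\<close>, and its index \<open>N - Suc j\<close> is again l.\<close>
  have *: "N - l = Suc (N - Suc l)" "N - Suc (N - Suc l) = l" using assms by auto
  show ?thesis unfolding Yproc_def * YJ.simps Let_def ..
qed

context square_integrable_noise
begin

section \<open>Square integrability of the state, variation and adjoint processes\<close>

lemma L2F_diff:
  fixes X Y :: "'a \<Rightarrow> real^'r::finite"
  assumes "L2F M w k X" "L2F M w k Y" "k \<le> N"
  shows "L2F M w k (\<lambda>\<omega>. X \<omega> - Y \<omega>)"
  using L2F_add[OF assms(1) L2F_scaleR[OF assms(2), of "-1"] assms(3)] by simp

lemma L2F_E_le: "L2F M w l X \<Longrightarrow> k \<le> l \<Longrightarrow> l \<le> N \<Longrightarrow> L2F M w l (E k X)"
  using L2F_E[OF L2F_mono[of l X N], of k] L2F_mono[of k _ l] by simp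

lemma L2F_fbU:
  assumes "L2F M w l X" "L2F M w l (v l)" "l \<le> N"
  shows "L2F M w l (fbU \<Phi> v l X)"
  unfolding fbU_def by (intro L2F_add L2F_matrix assms)

lemma L2F_mixU:
  assumes "L2F M w l X" "L2F M w l (v l)" "l \<le> N" "L2F M w k u"
  shows "L2F M w l (mixU k u \<Phi> v l X)"
  using assms L2F_fbU[of l X v \<Phi>] by (simp add: mixU_def)

text \<open>Stated for any policy that maps adapted square-integrable states to controls of the same
  kind; the feedback policy and its perturbation at one time are both instances.\<close>

lemma L2F_state:
  assumes \<xi>: "L2F M w s \<xi>"
    and U: "\<And>l X. s \<le> l \<Longrightarrow> l < N \<Longrightarrow> L2F M w l X \<Longrightarrow> L2F M w l (U l X)"
    and l: "s \<le> l" "l \<le> N"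
  shows "L2F M w l (state M w L s \<xi> U l)"
  using l
proof (induction l rule: dec_induct)
  case (step l)
  then have X: "L2F M w l (state M w L s \<xi> U l)" and l: "l < N" "Suc l \<le> N" "l \<le> N" by auto
  note u = U[OF step.hyps(1) l(1) X]
  \<comment> \<open>Terms known at time l are lifted to \<open>Suc l\<close>, the first time at
    which \<open>w l\<close> is measurable.\<close>
  have up: "L2F M w (Suc l) Z" if "L2F M w l Z" for Z :: "'a \<Rightarrow> real^'q::finite"
    using L2F_mono[OF that] by simp
  show ?case unfolding state_Suc[OF step.hyps(1)] Let_def
    by (intro L2F_add L2F_sum L2F_noise L2F_const) (auto intro!: L2F_add L2F_matrix up X u l L2F_E_le step.hyps)
qed (simp add: \<xi>)

lemma L2F_eqst:
  assumes x: "L2F M w t x" and v: "\<And>l. t \<le> l \<Longrightarrow> l < N \<Longrightarrow> L2F M w l (v l)" and l: "t \<le> l" "l \<le> N"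
  shows "L2F M w l (eqst w L t x \<Phi> v l)"
  using l
proof (induction l rule: dec_induct)
  case (step l)
  then have X: "L2F M w l (eqst w L t x \<Phi> v l)" and l: "l < N" "Suc l \<le> N" "l \<le> N" by auto
  note u = v[OF step.hyps(1) l(1)]
  have up: "L2F M w (Suc l) Z" if "L2F M w l Z" for Z :: "'a \<Rightarrow> real^'q::finite"
    using L2F_mono[OF that] by simp
  show ?case unfolding eqst_Suc[OF step.hyps(1)]
    by (intro L2F_add L2F_sum L2F_noise L2F_const) (auto intro!: L2F_add L2F_matrix up X u l)
qed (simp add: x)

lemma L2F_alpha:
  assumes ub: "L2F M w k ub" and l: "k \<le> l" "l \<le> N"
  shows "L2F M w l (alpha M w L k \<Phi> ub l)"
  using l
proof (induction l rule: dec_induct)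
  case (step l)
  then have X: "L2F M w l (alpha M w L k \<Phi> ub l)" and l: "l < N" "Suc l \<le> N" "l \<le> N" by auto
  have up: "L2F M w (Suc l) Z" if "L2F M w l Z" for Z :: "'a \<Rightarrow> real^'q::finite"
    using L2F_mono[OF that] by simp
  show ?case
  proof (cases "k = l")
    case True
    then show ?thesis unfolding alpha_Suc_init True
      by (intro L2F_add L2F_sum L2F_noise) (use ub l True in \<open>auto intro!: L2F_matrix up\<close>)
  next
    case False
    then have kl: "k < l" using step.hyps by simp
    show ?thesis unfolding alpha_Suc[OF kl] Let_def
      by (intro L2F_add L2F_sum L2F_noise) (auto intro!: L2F_add L2F_matrix up X l L2F_E_le step.hyps)
  qed
qed simp

text \<open>Going backward, the successor value is used only as a square-integrable variable at time
  \<open>N\<close>; the conditional expectations make it adapted again, and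
  \<open>L2F_E_noise_le\<close> covers its products with the noise.\<close>

lemma L2F_Yproc:
  assumes x: "L2F M w t x" and v: "\<And>l. t \<le> l \<Longrightarrow> l < N \<Longrightarrow> L2F M w l (v l)"
    and k: "t \<le> k" and l: "k \<le> l" "l \<le> N"
  shows "L2F M w l (Yproc M w L N t x \<Phi> v k l)"
  using l(2,1)
proof (induction l rule: inc_induct)
  case base
  have \<xi>: "L2F M w k (eqst w L t x \<Phi> v k)" using L2F_eqst[OF x v k] base by simp
  have X: "L2F M w N (Xfb M w L t x \<Phi> v k N)" unfolding Xfb_def
    using k base by (intro L2F_state \<xi> L2F_fbU v) auto
  show ?case unfolding Yproc_terminal Let_def
    by (intro L2F_add L2F_matrix L2F_const X L2F_E_le L2F_mono[OF \<xi>] order_refl base)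
next
  case (step l)
  then have kl: "k \<le> l" "l \<le> N" "l < N" "t \<le> l" "k \<le> N" using k by auto
  have \<xi>: "L2F M w k (eqst w L t x \<Phi> v k)" using L2F_eqst[OF x v k] kl by simp
  have X: "L2F M w l (Xfb M w L t x \<Phi> v k l)" unfolding Xfb_def
    using k kl by (intro L2F_state \<xi> L2F_fbU v) auto
  have Y: "L2F M w N (Yproc M w L N t x \<Phi> v k (Suc l))"
    using step kl by (intro L2F_mono[OF step.IH]) auto
  show ?case unfolding Yproc_step[OF kl(3)] Let_def
    by (intro L2F_add L2F_matrix L2F_const L2F_sum X L2F_E_le[OF X] L2F_E_le[of l] v L2F_E[OF Y]
        L2F_mono[OF L2F_E[OF Y, of k]] L2F_E_noise_le[OF Y] L2F_mono[OF L2F_E_noise_le[OF Y, of _ k]] kl order_refl)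
qed

section \<open>Perturbed states and costs\<close>

text \<open>Equality holds only almost surely because linearity of \<open>E k\<close> does. The two
  cases of the induction step match the two cases in the recursion of \<alpha>.\<close>

lemma state_perturbation:
  fixes \<Phi> :: "nat \<Rightarrow> real^'n::finite^'m::finite"
  assumes \<xi>: "L2F M w k \<xi>" and v: "\<And>l. k \<le> l \<Longrightarrow> l < N \<Longrightarrow> L2F M w l (v l)"
    and ub: "L2F M w k ub" and k: "k < N" and l: "k \<le> l" "l \<le> N"
  defines "u \<equiv> \<lambda>\<omega>. fbU \<Phi> v k \<xi> \<omega> + ub \<omega>"
  shows "AE \<omega> in M. state M w L k \<xi> (mixU k u \<Phi> v) l \<omega> =
    state M w L k \<xi> (fbU \<Phi> v) l \<omega> + alpha M w L k \<Phi> ub l \<omega>"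
  using l
proof (induction l rule: dec_induct)
  case (step l)
  then have l: "k \<le> l" "l < N" "l \<le> N" and kN: "k \<le> N" by auto
  have u: "L2F M w k u" unfolding u_def using k by (intro L2F_add L2F_fbU \<xi> v ub) auto
  define X where "X = state M w L k \<xi> (fbU \<Phi> v) l"
  define X' where "X' = state M w L k \<xi> (mixU k u \<Phi> v) l"
  define a where "a = alpha M w L k \<Phi> ub l"
  have IH: "AE \<omega> in M. X' \<omega> = X \<omega> + a \<omega>" unfolding X_def X'_def a_def using step l by auto
  have X: "L2F M w l X" unfolding X_def by (intro L2F_state \<xi> L2F_fbU v) (use l in auto)
  have X': "L2F M w l X'" unfolding X'_def by (intro L2F_state \<xi> L2F_mixU v u) (use l in auto)
  have a: "L2F M w l a" unfolding a_def by (intro L2F_alpha ub l)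
  note N = L2F_mono[OF _ l(3)]
  have EX: "AE \<omega> in M. E k X' \<omega> = E k X \<omega> + E k a \<omega>"
    by (rule E_add_AE[OF N[OF X] N[OF a] N[OF X'] kN IH])
  show ?case
  proof (cases "k = l")
    case True
    have X\<xi>: "X = \<xi>" "X' = \<xi>" "a = (\<lambda>_. 0)" using True by (simp_all add: X_def X'_def a_def)
    have ul: "mixU k u \<Phi> v l X' = u" using True by (simp add: mixU_def)
    \<comment> \<open>A control applied at time k is fixed by \<open>E k\<close>, so
      \<open>mB\<close> and \<open>mBb\<close> merge into \<open>cB\<close>, and \<open>mD\<close>
      and \<open>mDb\<close> into \<open>cD\<close>.\<close>
    have Eu: "AE \<omega> in M. E k u \<omega> = u \<omega>" by (rule E_F_measurable[OF u kN])
    have Euf: "AE \<omega> in M. E k (fbU \<Phi> v k \<xi>) \<omega> = fbU \<Phi> v k \<xi> \<omega>"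
      by (rule E_F_measurable[OF _ kN]) (intro L2F_fbU \<xi> v kN k order_refl)
    show ?thesis
      unfolding state_Suc[OF l(1)] Let_def X_def[symmetric] X'_def[symmetric] ul
      unfolding True[symmetric] alpha_Suc_init X\<xi>
      using Eu Euf
    proof eventually_elim
      fix \<omega>
      assume 1: "E k u \<omega> = u \<omega>" and 2: "E k (fbU \<Phi> v k \<xi>) \<omega> = fbU \<Phi> v k \<xi> \<omega>"
      show "mA L k k *v \<xi> \<omega> + mAb L k k *v E k \<xi> \<omega> + mB L k k *v u \<omega> + mBb L k k *v E k u \<omega> + vf L k k
        + (\<Sum>i\<in>UNIV. w k \<omega> $ i *\<^sub>R (mC L i k k *v \<xi> \<omega> + mCb L i k k *v E k \<xi> \<omega> + mD L i k k *v u \<omega>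
             + mDb L i k k *v E k u \<omega> + vd L i k k))
        = mA L k k *v \<xi> \<omega> + mAb L k k *v E k \<xi> \<omega> + mB L k k *v fbU \<Phi> v k \<xi> \<omega> + mBb L k k *v E k (fbU \<Phi> v k \<xi>) \<omega> + vf L k k
        + (\<Sum>i\<in>UNIV. w k \<omega> $ i *\<^sub>R (mC L i k k *v \<xi> \<omega> + mCb L i k k *v E k \<xi> \<omega> + mD L i k k *v fbU \<Phi> v k \<xi> \<omega>
             + mDb L i k k *v E k (fbU \<Phi> v k \<xi>) \<omega> + vd L i k k))
        + (cB L k k *v ub \<omega> + (\<Sum>i\<in>UNIV. w k \<omega> $ i *\<^sub>R (cD L i k k *v ub \<omega>)))"
        unfolding 1 2 unfolding u_def cB_def cD_def
        by (simp add: matrix_vector_right_distrib matrix_vector_mult_add_rdistrib sum.distrib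
            scaleR_right_distrib ac_simps)
    qed
  next
    case False
    then have kl: "k < l" using l by simp
    have ul: "mixU k u \<Phi> v l X' = fbU \<Phi> v l X'" using False by (simp add: mixU_def)
    have U: "L2F M w l (fbU \<Phi> v l X)" "L2F M w l (fbU \<Phi> v l X')" "L2F M w l (\<lambda>\<omega>. \<Phi> l *v a \<omega>)"
      by (intro L2F_fbU L2F_matrix X X' a v l)+
    \<comment> \<open>Later feedback controls react to the changed state, whereas the open-loop part
      \<open>v\<close> cancels in the difference.\<close>
    have "AE \<omega> in M. fbU \<Phi> v l X' \<omega> = fbU \<Phi> v l X \<omega> + \<Phi> l *v a \<omega>"
      using IH by eventually_elim (simp add: fbU_def matrix_vector_right_distrib)
    from E_add_AE[OF N[OF U(1)] N[OF U(3)] N[OF U(2)] kN this] E_matrix[OF N[OF a] kN, of "\<Phi> l"]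
    have Eu: "AE \<omega> in M. E k (fbU \<Phi> v l X') \<omega> = E k (fbU \<Phi> v l X) \<omega> + \<Phi> l *v E k a \<omega>"
      by eventually_elim simp
    show ?thesis
      unfolding state_Suc[OF l(1)] Let_def X_def[symmetric] X'_def[symmetric] ul alpha_Suc[OF kl] a_def[symmetric]
      using IH EX Eu
    proof eventually_elim
      fix \<omega>
      assume 1: "X' \<omega> = X \<omega> + a \<omega>" and 2: "E k X' \<omega> = E k X \<omega> + E k a \<omega>"
        and 3: "E k (fbU \<Phi> v l X') \<omega> = E k (fbU \<Phi> v l X) \<omega> + \<Phi> l *v E k a \<omega>"
      have 4: "fbU \<Phi> v l X' \<omega> = fbU \<Phi> v l X \<omega> + \<Phi> l *v a \<omega>"
        by (simp add: fbU_def matrix_vector_right_distrib 1)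
      show "mA L k l *v X' \<omega> + mAb L k l *v E k X' \<omega> + mB L k l *v fbU \<Phi> v l X' \<omega> + mBb L k l *v E k (fbU \<Phi> v l X') \<omega> + vf L k l
        + (\<Sum>i\<in>UNIV. w l \<omega> $ i *\<^sub>R (mC L i k l *v X' \<omega> + mCb L i k l *v E k X' \<omega> + mD L i k l *v fbU \<Phi> v l X' \<omega>
             + mDb L i k l *v E k (fbU \<Phi> v l X') \<omega> + vd L i k l))
        = mA L k l *v X \<omega> + mAb L k l *v E k X \<omega> + mB L k l *v fbU \<Phi> v l X \<omega> + mBb L k l *v E k (fbU \<Phi> v l X) \<omega> + vf L k l
        + (\<Sum>i\<in>UNIV. w l \<omega> $ i *\<^sub>R (mC L i k l *v X \<omega> + mCb L i k l *v E k X \<omega> + mD L i k l *v fbU \<Phi> v l X \<omega>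
             + mDb L i k l *v E k (fbU \<Phi> v l X) \<omega> + vd L i k l))
        + ((mA L k l + mB L k l ** \<Phi> l) *v a \<omega> + (mAb L k l + mBb L k l ** \<Phi> l) *v E k a \<omega>
           + (\<Sum>i\<in>UNIV. w l \<omega> $ i *\<^sub>R ((mC L i k l + mD L i k l ** \<Phi> l) *v a \<omega>
                 + (mCb L i k l + mDb L i k l ** \<Phi> l) *v E k a \<omega>)))"
        unfolding 1 2 3 4
        by (simp add: matrix_vector_right_distrib matrix_vector_mult_add_rdistrib sum.distrib
            scaleR_right_distrib ac_simps matrix_vector_mul_assoc)
    qed
  qed
qed simp

lemma alpha_scaleR:
  assumes ub: "L2F M w k ub" and l: "k \<le> l" "l \<le> N"
  shows "AE \<omega> in M. alpha M w L k \<Phi> (\<lambda>\<omega>. c *\<^sub>R ub \<omega>) l \<omega> = c *\<^sub>R alpha M w L k \<Phi> ub l \<omega>"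
  using l
proof (induction l rule: dec_induct)
  case (step l)
  then have l: "k \<le> l" "l < N" "l \<le> N" and kN: "k \<le> N" by auto
  define a where "a = alpha M w L k \<Phi> ub l"
  define a' where "a' = alpha M w L k \<Phi> (\<lambda>\<omega>. c *\<^sub>R ub \<omega>) l"
  have IH: "AE \<omega> in M. a' \<omega> = c *\<^sub>R a \<omega>" unfolding a_def a'_def using step l by auto
  have a: "L2F M w l a" unfolding a_def by (intro L2F_alpha ub l)
  have a': "L2F M w l a'" unfolding a'_def by (intro L2F_alpha L2F_scaleR ub l)
  note N = L2F_mono[OF _ l(3)]
  have "AE \<omega> in M. E k a' \<omega> = E k (\<lambda>\<omega>. c *\<^sub>R a \<omega>) \<omega>"
    by (rule E_cong_AE[OF IH]) (use a a' kN l in \<open>auto intro: L2F_borel L2F_scaleR\<close>)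
  with E_scaleR[OF N[OF a] kN, of c] have EI: "AE \<omega> in M. E k a' \<omega> = c *\<^sub>R E k a \<omega>"
    by eventually_elim simp
  show ?case
  proof (cases "k = l")
    case True
    show ?thesis unfolding True[symmetric] alpha_Suc_init
      by (simp add: matrix_vector_mult_scaleR scaleR_right_distrib scaleR_right.sum ac_simps)
  next
    case False
    then have kl: "k < l" using l by simp
    show ?thesis
      unfolding alpha_Suc[OF kl] Let_def a_def[symmetric] a'_def[symmetric]
      using IH EI
      by eventually_elim
        (simp add: matrix_vector_mult_scaleR scaleR_right_distrib scaleR_right.sum ac_simps)
  qed
qed simp

section \<open>Costs integrated over an event and their expansion\<close>

text \<open>The integral of \<open>Jcost\<close> over A. States and controls are free arguments, so
  that the expansion below is pure algebra, independent of the dynamics.\<close>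

definition cost :: "('n::finite,'m::finite,'p) lqdata \<Rightarrow> 'a set \<Rightarrow> nat \<Rightarrow> ('a \<Rightarrow> real^'n)
    \<Rightarrow> (nat \<Rightarrow> 'a \<Rightarrow> real^'n) \<Rightarrow> (nat \<Rightarrow> 'a \<Rightarrow> real^'m) \<Rightarrow> real" where
  "cost L A s \<xi> X u =
    (\<Sum>k=s..<N. ip A (X k) (\<lambda>\<omega>. mQ L s k *v X k \<omega>) + ip A (E s (X k)) (\<lambda>\<omega>. mQb L s k *v E s (X k) \<omega>)
       + ip A (u k) (\<lambda>\<omega>. mR L s k *v u k \<omega>) + ip A (E s (u k)) (\<lambda>\<omega>. mRb L s k *v E s (u k) \<omega>)
       + 2 * ip A (\<lambda>_. vq L s k) (X k) + 2 * ip A (\<lambda>_. vrho L s k) (u k))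
    + ip A (X N) (\<lambda>\<omega>. mG L s *v X N \<omega>) + ip A (E s (X N)) (\<lambda>\<omega>. mGb L s *v E s (X N) \<omega>)
    + 2 * ip A (\<lambda>\<omega>. mF L s *v \<xi> \<omega> + vg L s) (E s (X N))"

lemma has_F_int_Jcost:
  assumes \<xi>: "L2F M w s \<xi>"
    and U: "\<And>l X. s \<le> l \<Longrightarrow> l < N \<Longrightarrow> L2F M w l X \<Longrightarrow> L2F M w l (U l X)"
    and s: "s \<le> N" and A: "A \<in> sets (F s)"
  shows "has_F_int s A (Jcost M w L N s \<xi> U)
    (cost L A s \<xi> (state M w L s \<xi> U) (\<lambda>l. U l (state M w L s \<xi> U l)))"
proof -
  have AM: "A \<in> sets M" using A sets_F_subset[OF s] by auto
  have X': "L2F M w l (state M w L s \<xi> U l)" if "s \<le> l" "l \<le> N" for l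
    by (intro L2F_state \<xi> U that)
  have X: "L2F M w N (state M w L s \<xi> U l)" if "s \<le> l" "l \<le> N" for l
    by (rule L2F_mono[OF X'[OF that] that(2)])
  have u: "L2F M w N (U l (state M w L s \<xi> U l))" if "s \<le> l" "l < N" for l
    using U[OF that X'] that by (auto intro: L2F_mono)
  have E: "L2F M w s (E s Z)" "L2F M w N (E s Z)" if "L2F M w N Z" for Z :: "'a \<Rightarrow> real^'q::finite"
    using L2F_E[OF that s] L2F_mono[OF _ s] by auto
  show ?thesis
    unfolding Jcost_def cost_def Let_def
    by (intro has_F_int_add has_F_int_sum has_F_int_cond_exp has_F_int_cmult has_F_int_inner
        has_int_add has_int_cmult has_int_inner L2F_matrix L2F_add L2F_const AM A s order_refl \<xi>)
      (auto intro!: X u E s)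
qed

definition cost_tilde :: "('n::finite,'m::finite,'p) lqdata \<Rightarrow> 'a set \<Rightarrow> nat \<Rightarrow> (nat \<Rightarrow> real^'n^'m)
   \<Rightarrow> (nat \<Rightarrow> 'a \<Rightarrow> real^'n) \<Rightarrow> ('a \<Rightarrow> real^'m) \<Rightarrow> real" where
  "cost_tilde L A k \<Phi> a ub =
    (\<Sum>l=k..<N. ip A (a l) (\<lambda>\<omega>. (mQ L k l + transpose (\<Phi> l) ** mR L k l ** \<Phi> l) *v a l \<omega>)
       + ip A (E k (a l)) (\<lambda>\<omega>. (mQb L k l + transpose (\<Phi> l) ** mRb L k l ** \<Phi> l) *v E k (a l) \<omega>))
    + ip A ub (\<lambda>\<omega>. cR L k k *v ub \<omega>)
    + ip A (a N) (\<lambda>\<omega>. mG L k *v a N \<omega>) + ip A (E k (a N)) (\<lambda>\<omega>. mGb L k *v E k (a N) \<omega>)"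

lemma has_F_int_Jtilde:
  assumes ub: "L2F M w k ub" and k: "k \<le> N" and A: "A \<in> sets (F k)"
  shows "has_F_int k A (Jtilde M w L N k \<Phi> ub) (cost_tilde L A k \<Phi> (alpha M w L k \<Phi> ub) ub)"
proof -
  have AM: "A \<in> sets M" using A sets_F_subset[OF k] by auto
  have a: "L2F M w N (alpha M w L k \<Phi> ub l)" if "k \<le> l" "l \<le> N" for l
    by (rule L2F_mono[OF L2F_alpha[OF ub that] that(2)])
  have E: "L2F M w k (E k Z)" "L2F M w N (E k Z)" if "L2F M w N Z" for Z :: "'a \<Rightarrow> real^'q::finite"
    using L2F_E[OF that k] L2F_mono[OF _ k] by auto
  show ?thesis
    unfolding Jtilde_def cost_tilde_def Let_def
    by (intro has_F_int_add has_F_int_sum has_F_int_cond_exp has_F_int_inner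
        has_int_add has_int_inner L2F_matrix AM A k order_refl L2F_mono[OF ub k])
      (auto intro!: a E k)
qed

lemma ip_scaleR_AE:
  assumes X: "L2F M w N X" and Z: "L2F M w N Z" and A: "A \<in> sets M"
    and eq: "AE \<omega> in M. Z \<omega> = c *\<^sub>R X \<omega>"
  shows "ip A Z (\<lambda>\<omega>. Q *v Z \<omega>) = c\<^sup>2 * ip A X (\<lambda>\<omega>. Q *v X \<omega>)"
proof -
  have [measurable]: "X \<in> borel_measurable M" "Z \<in> borel_measurable M"
    using X Z by (auto intro: L2F_borel)
  have "ip A Z (\<lambda>\<omega>. Q *v Z \<omega>) = ip A (\<lambda>\<omega>. c *\<^sub>R X \<omega>) (\<lambda>\<omega>. Q *v (c *\<^sub>R X \<omega>))"
    by (rule ip_cong_AE) (use eq A in \<open>auto elim: eventually_mono\<close>)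
  also have "\<dots> = (\<integral>\<omega>. c\<^sup>2 * (indicator A \<omega> * (X \<omega> \<bullet> (Q *v X \<omega>))) \<partial>M)"
    unfolding ip_def by (simp add: matrix_vector_mult_scaleR power2_eq_square ac_simps)
  finally show ?thesis by (simp add: ip_def)
qed

text \<open>Degree two of \<open>Jtilde\<close>, against degree one of the linear term, is what
  allows scalings of a perturbation to separate the two.\<close>

lemma Jtilde_scaleR:
  assumes ub: "L2F M w k ub" and k: "k \<le> N"
  shows "AE \<omega> in M. Jtilde M w L N k \<Phi> (\<lambda>\<omega>. c *\<^sub>R ub \<omega>) \<omega> = c\<^sup>2 * Jtilde M w L N k \<Phi> ub \<omega>"
proof (rule AE_eq_of_F_integrals[OF k])
  fix A assume A: "A \<in> sets (F k)"
  then have AM: "A \<in> sets M" using sets_F_subset[OF k] by auto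
  let ?c = "\<lambda>\<omega>. c *\<^sub>R ub \<omega>"
  show "has_F_int k A (Jtilde M w L N k \<Phi> ?c) (cost_tilde L A k \<Phi> (alpha M w L k \<Phi> ?c) ?c)"
    by (intro has_F_int_Jtilde L2F_scaleR ub k A)
  have 1: "ip A (alpha M w L k \<Phi> ?c l) (\<lambda>\<omega>. Q *v alpha M w L k \<Phi> ?c l \<omega>)
        = c\<^sup>2 * ip A (alpha M w L k \<Phi> ub l) (\<lambda>\<omega>. Q *v alpha M w L k \<Phi> ub l \<omega>)"
    and 2: "ip A (E k (alpha M w L k \<Phi> ?c l)) (\<lambda>\<omega>. Q *v E k (alpha M w L k \<Phi> ?c l) \<omega>)
        = c\<^sup>2 * ip A (E k (alpha M w L k \<Phi> ub l)) (\<lambda>\<omega>. Q *v E k (alpha M w L k \<Phi> ub l) \<omega>)"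
    if l: "k \<le> l" "l \<le> N" for l Q
  proof -
    have a: "L2F M w N (alpha M w L k \<Phi> ub l)" "L2F M w N (alpha M w L k \<Phi> ?c l)"
      using l L2F_mono[OF L2F_alpha[OF ub l] l(2)] L2F_mono[OF L2F_alpha[OF L2F_scaleR[OF ub] l] l(2)] by auto
    note eq = alpha_scaleR[OF ub l, of L \<Phi> c]
    show "ip A (alpha M w L k \<Phi> ?c l) (\<lambda>\<omega>. Q *v alpha M w L k \<Phi> ?c l \<omega>)
        = c\<^sup>2 * ip A (alpha M w L k \<Phi> ub l) (\<lambda>\<omega>. Q *v alpha M w L k \<Phi> ub l \<omega>)"
      by (rule ip_scaleR_AE[OF a AM eq])
    have "AE \<omega> in M. E k (alpha M w L k \<Phi> ?c l) \<omega> = E k (\<lambda>\<omega>. c *\<^sub>R alpha M w L k \<Phi> ub l \<omega>) \<omega>"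
      by (rule E_cong_AE[OF eq]) (use a k in \<open>auto intro: L2F_borel L2F_scaleR\<close>)
    with E_scaleR[OF a(1) k, of c]
    have "AE \<omega> in M. E k (alpha M w L k \<Phi> ?c l) \<omega> = c *\<^sub>R E k (alpha M w L k \<Phi> ub l) \<omega>"
      by eventually_elim simp
    then show "ip A (E k (alpha M w L k \<Phi> ?c l)) (\<lambda>\<omega>. Q *v E k (alpha M w L k \<Phi> ?c l) \<omega>)
        = c\<^sup>2 * ip A (E k (alpha M w L k \<Phi> ub l)) (\<lambda>\<omega>. Q *v E k (alpha M w L k \<Phi> ub l) \<omega>)"
      by (intro ip_scaleR_AE L2F_mono[OF L2F_E[OF a(1) k] k] L2F_mono[OF L2F_E[OF a(2) k] k] AM)
  qed
  have 3: "ip A ?c (\<lambda>\<omega>. cR L k k *v ?c \<omega>) = c\<^sup>2 * ip A ub (\<lambda>\<omega>. cR L k k *v ub \<omega>)"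
    by (intro ip_scaleR_AE AM L2F_scaleR L2F_mono[OF ub k]) auto
  have "cost_tilde L A k \<Phi> (alpha M w L k \<Phi> ?c) ?c = c\<^sup>2 * cost_tilde L A k \<Phi> (alpha M w L k \<Phi> ub) ub"
    unfolding cost_tilde_def 3 1[OF k order_refl] 2[OF k order_refl] distrib_left sum_distrib_left
    by (intro arg_cong2[where f = "(+)"] sum.cong refl) (auto simp: 1 2)
  then show "has_F_int k A (\<lambda>\<omega>. c\<^sup>2 * Jtilde M w L N k \<Phi> ub \<omega>) (cost_tilde L A k \<Phi> (alpha M w L k \<Phi> ?c) ?c)"
    using has_F_int_cmult[OF has_F_int_Jtilde[OF ub k A]] by simp
qed

lemma ip_E_left:
  assumes X: "L2F M w N X" and Z: "L2F M w k Z" and A: "A \<in> sets (F k)" and k: "k \<le> N"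
  shows "ip A (E k X) Z = ip A X Z"
  using ip_E_right[OF Z X A order_refl k] by (simp add: ip_commute)

lemma ip_cong_AE_left:
  assumes X: "L2F M w N X" and X': "L2F M w N X'" and Y: "L2F M w N Y" and A: "A \<in> sets M"
    and eq: "AE \<omega> in M. X \<omega> = X' \<omega>"
  shows "ip A X Y = ip A X' Y"
  by (rule ip_cong_AE[OF eq]) (use X X' Y A in \<open>auto intro: L2F_borel\<close>)

text \<open>Half the first variation of the running cost at (X, u) in the direction (a, b); the
  factor 2 stays outside.\<close>

definition cost_linear :: "('n::finite,'m::finite,'p) lqdata \<Rightarrow> 'a set \<Rightarrow> nat \<Rightarrow> nat
    \<Rightarrow> ('a \<Rightarrow> real^'n) \<Rightarrow> ('a \<Rightarrow> real^'m) \<Rightarrow> ('a \<Rightarrow> real^'n) \<Rightarrow> ('a \<Rightarrow> real^'m) \<Rightarrow> real" where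
  "cost_linear L A k l X u a b =
     ip A a (\<lambda>\<omega>. mQ L k l *v X \<omega>) + ip A (E k a) (\<lambda>\<omega>. mQb L k l *v E k X \<omega>)
     + ip A b (\<lambda>\<omega>. mR L k l *v u \<omega>) + ip A (E k b) (\<lambda>\<omega>. mRb L k l *v E k u \<omega>)
     + ip A (\<lambda>_. vq L k l) a + ip A (\<lambda>_. vrho L k l) b"

text \<open>Half the first variation of the terminal cost. The initial state \<xi> is not perturbed,
  so the term with \<open>mF\<close> is linear in the final state and contributes here but not to
  the quadratic part.\<close>

definition cost_linear_terminal :: "('n::finite,'m::finite,'p) lqdata \<Rightarrow> 'a set \<Rightarrow> nat \<Rightarrow> ('a \<Rightarrow> real^'n)
    \<Rightarrow> ('a \<Rightarrow> real^'n) \<Rightarrow> ('a \<Rightarrow> real^'n) \<Rightarrow> real" where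
  "cost_linear_terminal L A k \<xi> X a =
     ip A a (\<lambda>\<omega>. mG L k *v X \<omega>) + ip A (E k a) (\<lambda>\<omega>. mGb L k *v E k X \<omega>)
     + ip A (\<lambda>\<omega>. mF L k *v \<xi> \<omega> + vg L k) (E k a)"

definition cost_quadratic :: "('n::finite,'m::finite,'p) lqdata \<Rightarrow> 'a set \<Rightarrow> nat \<Rightarrow> nat
    \<Rightarrow> ('a \<Rightarrow> real^'n) \<Rightarrow> ('a \<Rightarrow> real^'m) \<Rightarrow> real" where
  "cost_quadratic L A k l a b =
     ip A a (\<lambda>\<omega>. mQ L k l *v a \<omega>) + ip A (E k a) (\<lambda>\<omega>. mQb L k l *v E k a \<omega>)
     + ip A b (\<lambda>\<omega>. mR L k l *v b \<omega>) + ip A (E k b) (\<lambda>\<omega>. mRb L k l *v E k b \<omega>)"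

text \<open>An exact expansion without remainder; the symmetry of the weights merges the two cross
  terms of each quadratic form.\<close>

lemma cost_perturbation:
  fixes X X' a :: "nat \<Rightarrow> 'a \<Rightarrow> real^'n::finite" and u u' b :: "nat \<Rightarrow> 'a \<Rightarrow> real^'m::finite"
  assumes s: "s < N" and A: "A \<in> sets (F s)" and \<xi>: "L2F M w s \<xi>"
    and X: "\<And>l. s \<le> l \<Longrightarrow> l \<le> N \<Longrightarrow> L2F M w N (X l)"
    and a: "\<And>l. s \<le> l \<Longrightarrow> l \<le> N \<Longrightarrow> L2F M w N (a l)"
    and X': "\<And>l. s \<le> l \<Longrightarrow> l \<le> N \<Longrightarrow> L2F M w N (X' l)"
    and u: "\<And>l. s \<le> l \<Longrightarrow> l < N \<Longrightarrow> L2F M w N (u l)"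
    and b: "\<And>l. s \<le> l \<Longrightarrow> l < N \<Longrightarrow> L2F M w N (b l)"
    and u': "\<And>l. s \<le> l \<Longrightarrow> l < N \<Longrightarrow> L2F M w N (u' l)"
    and Xa: "\<And>l. s \<le> l \<Longrightarrow> l \<le> N \<Longrightarrow> AE \<omega> in M. X' l \<omega> = X l \<omega> + a l \<omega>"
    and ub: "\<And>l. s \<le> l \<Longrightarrow> l < N \<Longrightarrow> AE \<omega> in M. u' l \<omega> = u l \<omega> + b l \<omega>"
    and sym: "\<And>l. s \<le> l \<Longrightarrow> l < N \<Longrightarrow> transpose (mQ L s l) = mQ L s l \<and> transpose (mQb L s l) = mQb L s l \<and>
        transpose (mR L s l) = mR L s l \<and> transpose (mRb L s l) = mRb L s l"
    and symG: "transpose (mG L s) = mG L s" "transpose (mGb L s) = mGb L s"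
  shows "cost L A s \<xi> X' u' = cost L A s \<xi> X u
     + ((\<Sum>l=s..<N. cost_quadratic L A s l (a l) (b l))
         + ip A (a N) (\<lambda>\<omega>. mG L s *v a N \<omega>) + ip A (E s (a N)) (\<lambda>\<omega>. mGb L s *v E s (a N) \<omega>))
     + 2 * ((\<Sum>l=s..<N. cost_linear L A s l (X l) (u l) (a l) (b l)) + cost_linear_terminal L A s \<xi> (X N) (a N))"
proof -
  have sN: "s \<le> N" using s by simp
  have AM: "A \<in> sets M" using A sets_F_subset[OF sN] by auto
  have E: "L2F M w N (E s Z)" if "L2F M w N Z" for Z :: "'a \<Rightarrow> real^'q::finite"
    using L2F_mono[OF L2F_E[OF that sN] sN] .
  have EXa: "AE \<omega> in M. E s (X' l) \<omega> = E s (X l) \<omega> + E s (a l) \<omega>" if "s \<le> l" "l \<le> N" for l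
    by (rule E_add_AE[OF X a X' sN Xa]) (use that in auto)
  have Eub: "AE \<omega> in M. E s (u' l) \<omega> = E s (u l) \<omega> + E s (b l) \<omega>" if "s \<le> l" "l < N" for l
    by (rule E_add_AE[OF u b u' sN ub]) (use that in auto)
  let ?r = "\<lambda>X u l. ip A (X l) (\<lambda>\<omega>. mQ L s l *v X l \<omega>) + ip A (E s (X l)) (\<lambda>\<omega>. mQb L s l *v E s (X l) \<omega>)
       + ip A (u l) (\<lambda>\<omega>. mR L s l *v u l \<omega>) + ip A (E s (u l)) (\<lambda>\<omega>. mRb L s l *v E s (u l) \<omega>)
       + 2 * ip A (\<lambda>_. vq L s l) (X l) + 2 * ip A (\<lambda>_. vrho L s l) (u l)"
  have run: "?r X' u' l = ?r X u l + (cost_quadratic L A s l (a l) (b l) + 2 * cost_linear L A s l (X l) (u l) (a l) (b l))"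
    if l: "l \<in> {s..<N}" for l
  proof -
    have l': "s \<le> l" "l < N" "l \<le> N" using l by auto
    note sy = sym[OF l'(1,2)]
    have "ip A (X' l) (\<lambda>\<omega>. mQ L s l *v X' l \<omega>) = ip A (X l) (\<lambda>\<omega>. mQ L s l *v X l \<omega>)
        + ip A (a l) (\<lambda>\<omega>. mQ L s l *v a l \<omega>) + 2 * ip A (a l) (\<lambda>\<omega>. mQ L s l *v X l \<omega>)"
      using sy by (intro ip_quadratic_add_AE X a X' Xa AM l') auto
    moreover have "ip A (E s (X' l)) (\<lambda>\<omega>. mQb L s l *v E s (X' l) \<omega>) = ip A (E s (X l)) (\<lambda>\<omega>. mQb L s l *v E s (X l) \<omega>)
        + ip A (E s (a l)) (\<lambda>\<omega>. mQb L s l *v E s (a l) \<omega>) + 2 * ip A (E s (a l)) (\<lambda>\<omega>. mQb L s l *v E s (X l) \<omega>)"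
      using sy by (intro ip_quadratic_add_AE E X a X' EXa AM l') auto
    moreover have "ip A (u' l) (\<lambda>\<omega>. mR L s l *v u' l \<omega>) = ip A (u l) (\<lambda>\<omega>. mR L s l *v u l \<omega>)
        + ip A (b l) (\<lambda>\<omega>. mR L s l *v b l \<omega>) + 2 * ip A (b l) (\<lambda>\<omega>. mR L s l *v u l \<omega>)"
      using sy by (intro ip_quadratic_add_AE u b u' ub AM l') auto
    moreover have "ip A (E s (u' l)) (\<lambda>\<omega>. mRb L s l *v E s (u' l) \<omega>) = ip A (E s (u l)) (\<lambda>\<omega>. mRb L s l *v E s (u l) \<omega>)
        + ip A (E s (b l)) (\<lambda>\<omega>. mRb L s l *v E s (b l) \<omega>) + 2 * ip A (E s (b l)) (\<lambda>\<omega>. mRb L s l *v E s (u l) \<omega>)"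
      using sy by (intro ip_quadratic_add_AE E u b u' Eub AM l') auto
    moreover have "ip A (\<lambda>_. vq L s l) (X' l) = ip A (\<lambda>_. vq L s l) (X l) + ip A (\<lambda>_. vq L s l) (a l)"
      by (intro ip_add_right_AE X a X' Xa AM l' L2F_const)
    moreover have "ip A (\<lambda>_. vrho L s l) (u' l) = ip A (\<lambda>_. vrho L s l) (u l) + ip A (\<lambda>_. vrho L s l) (b l)"
      by (intro ip_add_right_AE u b u' ub AM l' L2F_const)
    ultimately show ?thesis by (simp add: cost_quadratic_def cost_linear_def)
  qed
  note N = sN order_refl
  have "ip A (X' N) (\<lambda>\<omega>. mG L s *v X' N \<omega>) = ip A (X N) (\<lambda>\<omega>. mG L s *v X N \<omega>)
      + ip A (a N) (\<lambda>\<omega>. mG L s *v a N \<omega>) + 2 * ip A (a N) (\<lambda>\<omega>. mG L s *v X N \<omega>)"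
    by (intro ip_quadratic_add_AE X a X' Xa AM N symG)
  moreover have "ip A (E s (X' N)) (\<lambda>\<omega>. mGb L s *v E s (X' N) \<omega>) = ip A (E s (X N)) (\<lambda>\<omega>. mGb L s *v E s (X N) \<omega>)
      + ip A (E s (a N)) (\<lambda>\<omega>. mGb L s *v E s (a N) \<omega>) + 2 * ip A (E s (a N)) (\<lambda>\<omega>. mGb L s *v E s (X N) \<omega>)"
    by (intro ip_quadratic_add_AE E X a X' EXa AM N symG)
  moreover have "ip A (\<lambda>\<omega>. mF L s *v \<xi> \<omega> + vg L s) (E s (X' N))
      = ip A (\<lambda>\<omega>. mF L s *v \<xi> \<omega> + vg L s) (E s (X N)) + ip A (\<lambda>\<omega>. mF L s *v \<xi> \<omega> + vg L s) (E s (a N))"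
    by (intro ip_add_right_AE E X a X' EXa AM N L2F_add L2F_matrix L2F_const L2F_mono[OF \<xi> sN])
  moreover have "(\<Sum>l=s..<N. ?r X' u' l) = (\<Sum>l=s..<N. ?r X u l
      + (cost_quadratic L A s l (a l) (b l) + 2 * cost_linear L A s l (X l) (u l) (a l) (b l)))"
    by (intro sum.cong refl run)
  then have "(\<Sum>l=s..<N. ?r X' u' l) = (\<Sum>l=s..<N. ?r X u l) + ((\<Sum>l=s..<N. cost_quadratic L A s l (a l) (b l))
      + 2 * (\<Sum>l=s..<N. cost_linear L A s l (X l) (u l) (a l) (b l)))"
    unfolding sum.distrib[of "?r X u"] by (simp only: sum.distrib sum_distrib_left)
  ultimately show ?thesis
    unfolding cost_def cost_linear_terminal_def distrib_left by linarith
qed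

end

section \<open>Duality with the adjoint process\<close>

text \<open>A candidate pair together with a single time k, at which the equilibrium inequality is
  examined.\<close>

locale lq_problem = square_integrable_noise M w N \<Delta>
  for M :: "'a measure" and w :: "nat \<Rightarrow> 'a \<Rightarrow> real^'p::finite" and N :: nat and \<Delta> :: "nat \<Rightarrow> real^'p^'p" +
  fixes L :: "('n::finite,'m::finite,'p) lqdata"
    and t :: nat and x :: "'a \<Rightarrow> real^'n" and \<Phi> :: "nat \<Rightarrow> real^'n^'m" and v :: "nat \<Rightarrow> 'a \<Rightarrow> real^'m"
    and k :: nat
  assumes symmetric: "\<And>s l. s \<le> l \<Longrightarrow> l < N \<Longrightarrow> transpose (mQ L s l) = mQ L s l \<and> transpose (mQb L s l) = mQb L s l \<and>
        transpose (mR L s l) = mR L s l \<and> transpose (mRb L s l) = mRb L s l"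
    and symmetric_terminal: "\<And>s. s < N \<Longrightarrow> transpose (mG L s) = mG L s \<and> transpose (mGb L s) = mGb L s"
    and L2F_x: "L2F M w t x"
    and L2F_v: "\<And>l. t \<le> l \<Longrightarrow> l < N \<Longrightarrow> L2F M w l (v l)"
    and k: "t \<le> k" "k < N"
begin

abbreviation "X l \<equiv> Xfb M w L t x \<Phi> v k l"
abbreviation "Y l \<equiv> Yproc M w L N t x \<Phi> v k l"
abbreviation "\<alpha> ub l \<equiv> alpha M w L k \<Phi> ub l"
abbreviation "\<xi> \<equiv> eqst w L t x \<Phi> v k"

lemma k_le: "k \<le> N" using k by simp

lemma sets_Fk: "A \<in> sets (F k) \<Longrightarrow> A \<in> sets M"
  using sets_F_subset[OF k_le] by auto

lemma L2F_N_E: "L2F M w N Z \<Longrightarrow> L2F M w N (E k Z)"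
  using L2F_mono[OF L2F_E[OF _ k_le] k_le] .

lemma L2F_initial: "L2F M w k \<xi>"
  using L2F_eqst[OF L2F_x L2F_v k(1)] k by simp

lemma L2F_X: "k \<le> l \<Longrightarrow> l \<le> N \<Longrightarrow> L2F M w l (X l)"
  unfolding Xfb_def using k by (intro L2F_state L2F_initial L2F_fbU L2F_v) auto

lemma L2F_Y: "k \<le> l \<Longrightarrow> l \<le> N \<Longrightarrow> L2F M w l (Y l)"
  by (rule L2F_Yproc[OF L2F_x L2F_v k(1)])

text \<open>Each coefficient in the recursion of \<alpha> reappears transposed in that of Y, and
  transposition for \<open>ip A\<close> cancels these terms in pairs; what is left of Y is the
  gradient of the running cost along the feedback control. Time k is excluded because the first step
  of \<alpha> is driven by \<open>ub\<close>.\<close>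

lemma Yproc_duality_step:
  assumes ub: "L2F M w k ub" and A: "A \<in> sets (F k)" and l: "k < l" "l < N"
  shows "ip A (\<alpha> ub l) (Y l) = ip A (\<alpha> ub (Suc l)) (Y (Suc l))
    + cost_linear L A k l (X l) (fbU \<Phi> v l (X l)) (\<alpha> ub l) (\<lambda>\<omega>. \<Phi> l *v \<alpha> ub l \<omega>)"
proof -
  note AM = sets_Fk[OF A]
  have l': "k \<le> l" "l \<le> N" "t \<le> l" using l k by auto
  define a where "a = \<alpha> ub l"
  define Z where "Z = X l"
  define Y' where "Y' = Y (Suc l)"
  define b where "b = (\<lambda>\<omega>. \<Phi> l *v a \<omega>)"
  have al: "L2F M w l a" unfolding a_def by (intro L2F_alpha ub l')
  have Zl: "L2F M w l Z" unfolding Z_def by (intro L2F_X l')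
  have vl: "L2F M w l (v l)" by (intro L2F_v l' l)
  have Y'N: "L2F M w N Y'" unfolding Y'_def using l l' by (intro L2F_mono[OF L2F_Y]) auto
  note mN = L2F_mono[OF _ l'(2)]
  note aN = mN[OF al] and ZN = mN[OF Zl] and vN = mN[OF vl]
  have bN: "L2F M w N b" unfolding b_def by (intro L2F_matrix aN order_refl)
  have noise: "L2F M w N (\<lambda>\<omega>. w l \<omega> $ i *\<^sub>R V \<omega>)" if "L2F M w l V" for V :: "'a \<Rightarrow> real^'q::finite" and i
    using L2F_mono[OF L2F_noise[OF that l(2)]] l by simp
  have Elnoise: "L2F M w N (E l (\<lambda>\<eta>. w l \<eta> $ i *\<^sub>R Y' \<eta>))"
    and Eknoise: "L2F M w N (E k (\<lambda>\<eta>. w l \<eta> $ i *\<^sub>R Y' \<eta>))" for i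
    using mN[OF L2F_E_noise[OF Y'N l(2)]] L2F_mono[OF L2F_E_noise_le[OF Y'N l(2) l'(1)] k_le] by auto
  have ElY: "L2F M w N (E l Y')" using mN[OF L2F_E[OF Y'N l'(2)]] .
  define P where "P = mA L k l + mB L k l ** \<Phi> l"
  define Pb where "Pb = mAb L k l + mBb L k l ** \<Phi> l"
  define S where "S i = mC L i k l + mD L i k l ** \<Phi> l" for i
  define Sb where "Sb i = mCb L i k l + mDb L i k l ** \<Phi> l" for i
  \<comment> \<open>The weights with \<Phi> on both sides are multiplied out so that their outer
    factor can be moved onto \<open>a\<close>, giving the control variation
    \<open>b\<close>.\<close>
  have Y_eq: "Y l = (\<lambda>\<omega>. mQ L k l *v Z \<omega> + transpose (\<Phi> l) *v (mR L k l *v (\<Phi> l *v Z \<omega>))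
         + (mQb L k l *v E k Z \<omega> + transpose (\<Phi> l) *v (mRb L k l *v (\<Phi> l *v E k Z \<omega>)))
         + transpose (\<Phi> l) *v (mR L k l *v v l \<omega>)
         + transpose (\<Phi> l) *v (mRb L k l *v E k (v l) \<omega>)
         + transpose P *v E l Y' \<omega>
         + transpose Pb *v E k Y' \<omega>
         + (\<Sum>i\<in>UNIV. transpose (S i) *v E l (\<lambda>\<eta>. (w l \<eta> $ i) *\<^sub>R Y' \<eta>) \<omega>
             + transpose (Sb i) *v E k (\<lambda>\<eta>. (w l \<eta> $ i) *\<^sub>R Y' \<eta>) \<omega>)
         + transpose (\<Phi> l) *v vrho L k l + vq L k l)"
    unfolding Yproc_step[OF l(2)] Let_def Z_def Y'_def P_def Pb_def S_def Sb_def
    by (simp only: matrix_vector_mult_add_rdistrib matrix_vector_mul_assoc matrix_mul_assoc)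
  have Y_ip: "ip A a (Y l) = ip A a (\<lambda>\<omega>. mQ L k l *v Z \<omega>) + ip A b (\<lambda>\<omega>. mR L k l *v (\<Phi> l *v Z \<omega>))
      + (ip A a (\<lambda>\<omega>. mQb L k l *v E k Z \<omega>) + ip A b (\<lambda>\<omega>. mRb L k l *v (\<Phi> l *v E k Z \<omega>)))
      + ip A b (\<lambda>\<omega>. mR L k l *v v l \<omega>)
      + ip A b (\<lambda>\<omega>. mRb L k l *v E k (v l) \<omega>)
      + ip A (\<lambda>\<omega>. P *v a \<omega>) (E l Y')
      + ip A (\<lambda>\<omega>. Pb *v a \<omega>) (E k Y')
      + (\<Sum>i\<in>UNIV. ip A (\<lambda>\<omega>. S i *v a \<omega>) (E l (\<lambda>\<eta>. (w l \<eta> $ i) *\<^sub>R Y' \<eta>))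
          + ip A (\<lambda>\<omega>. Sb i *v a \<omega>) (E k (\<lambda>\<eta>. (w l \<eta> $ i) *\<^sub>R Y' \<eta>)))
      + ip A b (\<lambda>\<omega>. vrho L k l) + ip A a (\<lambda>_. vq L k l)"
    unfolding Y_eq b_def ip_transpose[symmetric]
    \<comment> \<open>\<open>ip_transpose\<close> has been applied from right to left: both sides
      now pair \<open>a\<close> with the same summands, and additivity is all that remains.\<close>
    by (subst ip_add_right ip_sum_right, (intro L2F_add L2F_matrix L2F_sum L2F_const aN ZN vN L2F_N_E Y'N Elnoise Eknoise ElY AM order_refl)+)+ (rule refl)
  have E_mat: "ip A (E k (\<lambda>\<omega>. V *v a \<omega>)) Y' = ip A (\<lambda>\<omega>. V *v E k a \<omega>) Y'" for V :: "real^'n^'n"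
    by (intro ip_cong_AE_left E_matrix aN k_le Y'N AM L2F_matrix L2F_N_E order_refl)
  have \<alpha>_ip: "ip A (\<alpha> ub (Suc l)) Y' = ip A (\<lambda>\<omega>. P *v a \<omega>) Y' + ip A (\<lambda>\<omega>. Pb *v E k a \<omega>) Y'
      + (\<Sum>i\<in>UNIV. ip A (\<lambda>\<omega>. w l \<omega> $ i *\<^sub>R (S i *v a \<omega>)) Y' + ip A (\<lambda>\<omega>. w l \<omega> $ i *\<^sub>R (Sb i *v E k a \<omega>)) Y')"
    unfolding alpha_Suc[OF l(1)] Let_def a_def[symmetric] P_def[symmetric] Pb_def[symmetric]
      S_def[symmetric] Sb_def[symmetric] scaleR_right_distrib
    by (subst ip_add_left ip_sum_left, (intro L2F_add L2F_matrix L2F_sum aN al L2F_N_E L2F_E_le Y'N noise AM l' order_refl)+)+ (rule refl)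
  have P1: "ip A (\<lambda>\<omega>. P *v a \<omega>) (E l Y') = ip A (\<lambda>\<omega>. P *v a \<omega>) Y'"
    by (intro ip_E_right[OF _ Y'N A l'(1,2)] L2F_matrix al l')
  have P2: "ip A (\<lambda>\<omega>. Pb *v a \<omega>) (E k Y') = ip A (\<lambda>\<omega>. Pb *v E k a \<omega>) Y'"
    unfolding E_mat[symmetric] by (intro ip_E_swap L2F_matrix aN Y'N A k_le order_refl)
  have P3: "ip A (\<lambda>\<omega>. S i *v a \<omega>) (E l (\<lambda>\<eta>. (w l \<eta> $ i) *\<^sub>R Y' \<eta>)) = ip A (\<lambda>\<omega>. w l \<omega> $ i *\<^sub>R (S i *v a \<omega>)) Y'" for i
    by (intro ip_E_noise_right[OF _ Y'N A] L2F_matrix al l l' order_refl)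
  have P4: "ip A (\<lambda>\<omega>. Sb i *v a \<omega>) (E k (\<lambda>\<eta>. (w l \<eta> $ i) *\<^sub>R Y' \<eta>)) = ip A (\<lambda>\<omega>. w l \<omega> $ i *\<^sub>R (Sb i *v E k a \<omega>)) Y'" for i
  proof -
    have eq: "AE \<omega> in M. w l \<omega> $ i *\<^sub>R E k (\<lambda>\<omega>. Sb i *v a \<omega>) \<omega> = w l \<omega> $ i *\<^sub>R (Sb i *v E k a \<omega>)"
      using E_matrix[OF aN k_le, of "Sb i"] by eventually_elim simp
    have "ip A (\<lambda>\<omega>. Sb i *v a \<omega>) (E k (\<lambda>\<eta>. (w l \<eta> $ i) *\<^sub>R Y' \<eta>)) = ip A (\<lambda>\<omega>. w l \<omega> $ i *\<^sub>R E k (\<lambda>\<omega>. Sb i *v a \<omega>) \<omega>) Y'"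
      by (intro ip_E_noise_swap L2F_matrix aN Y'N A k_le order_refl l l')
    also have "\<dots> = ip A (\<lambda>\<omega>. w l \<omega> $ i *\<^sub>R (Sb i *v E k a \<omega>)) Y'"
      by (intro ip_cong_AE_left[OF _ _ _ _ eq] noise L2F_matrix L2F_E_le al Y'N AM l')
    finally show ?thesis .
  qed
  \<comment> \<open>The cost pairs \<open>E k a\<close> with a mean-field term, Y pairs
    \<open>a\<close> itself with it; the two agree since that term is measurable at time k.\<close>
  have Q1: "ip A (E k a) (\<lambda>\<omega>. mQb L k l *v E k Z \<omega>) = ip A a (\<lambda>\<omega>. mQb L k l *v E k Z \<omega>)"
    by (intro ip_E_left aN L2F_matrix L2F_E ZN A k_le)
  have U: "L2F M w N (fbU \<Phi> v l Z)" unfolding fbU_def by (intro L2F_add L2F_matrix ZN vN order_refl)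
  have Q2: "ip A b (\<lambda>\<omega>. mR L k l *v fbU \<Phi> v l Z \<omega>) = ip A b (\<lambda>\<omega>. mR L k l *v (\<Phi> l *v Z \<omega>)) + ip A b (\<lambda>\<omega>. mR L k l *v v l \<omega>)"
    unfolding fbU_def matrix_vector_right_distrib by (intro ip_add_right L2F_matrix ZN vN bN AM order_refl)
  have "AE \<omega> in M. E k (fbU \<Phi> v l Z) \<omega> = E k (\<lambda>\<omega>. \<Phi> l *v Z \<omega>) \<omega> + E k (v l) \<omega>"
    unfolding fbU_def by (intro E_add L2F_matrix ZN vN k_le order_refl)
  with E_matrix[OF ZN k_le, of "\<Phi> l"]
  have "AE \<omega> in M. mRb L k l *v E k (fbU \<Phi> v l Z) \<omega> = mRb L k l *v (\<Phi> l *v E k Z \<omega>) + mRb L k l *v E k (v l) \<omega>"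
    by eventually_elim (simp add: matrix_vector_right_distrib)
  then have Q3: "ip A b (\<lambda>\<omega>. mRb L k l *v E k (fbU \<Phi> v l Z) \<omega>)
      = ip A b (\<lambda>\<omega>. mRb L k l *v (\<Phi> l *v E k Z \<omega>)) + ip A b (\<lambda>\<omega>. mRb L k l *v E k (v l) \<omega>)"
    by (intro ip_add_right_AE L2F_matrix L2F_N_E ZN vN bN U AM order_refl)
  have Q4: "ip A (E k b) (\<lambda>\<omega>. mRb L k l *v E k (fbU \<Phi> v l Z) \<omega>) = ip A b (\<lambda>\<omega>. mRb L k l *v E k (fbU \<Phi> v l Z) \<omega>)"
    by (intro ip_E_left bN L2F_matrix L2F_E U A k_le)
  show ?thesis
    unfolding cost_linear_def a_def[symmetric] Z_def[symmetric] Y'_def[symmetric] b_def[symmetric]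
      Y_ip \<alpha>_ip P1 P2 P3 P4 Q1 Q2 Q3 Q4
    by (simp add: ip_commute[of A "\<lambda>_. vq L k l"] ip_commute[of A "\<lambda>_. vrho L k l"])
qed

lemma Yproc_duality_terminal:
  assumes ub: "L2F M w k ub" and A: "A \<in> sets (F k)"
  shows "ip A (\<alpha> ub N) (Y N) = cost_linear_terminal L A k \<xi> (X N) (\<alpha> ub N)"
proof -
  note AM = sets_Fk[OF A]
  have aN: "L2F M w N (\<alpha> ub N)" and XN: "L2F M w N (X N)"
    by (intro L2F_alpha ub L2F_X k_le order_refl)+
  note \<xi>N = L2F_mono[OF L2F_initial k_le]
  have c: "L2F M w k (\<lambda>\<omega>. mF L k *v \<xi> \<omega> + vg L k)"
    by (intro L2F_add L2F_matrix L2F_initial L2F_const k_le)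
  have "ip A (\<alpha> ub N) (Y N) = ip A (\<alpha> ub N) (\<lambda>\<omega>. mG L k *v X N \<omega>)
      + ip A (\<alpha> ub N) (\<lambda>\<omega>. mGb L k *v E k (X N) \<omega>) + ip A (\<alpha> ub N) (\<lambda>\<omega>. mF L k *v \<xi> \<omega> + vg L k)"
    \<comment> \<open>Reassociation keeps the \<open>mF\<close> term and \<open>vg\<close> together
      as the single vector that the terminal cost uses.\<close>
    unfolding Yproc_terminal Let_def add.assoc[of "_ + _" "_ *v eqst _ _ _ _ _ _ _ _"]
    by (subst ip_add_right, (intro L2F_add L2F_matrix L2F_const aN XN \<xi>N L2F_N_E AM order_refl)+)+ (rule refl)
  moreover have "ip A (E k (\<alpha> ub N)) (\<lambda>\<omega>. mGb L k *v E k (X N) \<omega>) = ip A (\<alpha> ub N) (\<lambda>\<omega>. mGb L k *v E k (X N) \<omega>)"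
    by (intro ip_E_left aN L2F_matrix L2F_E XN A k_le)
  moreover have "ip A (\<lambda>\<omega>. mF L k *v \<xi> \<omega> + vg L k) (E k (\<alpha> ub N)) = ip A (\<alpha> ub N) (\<lambda>\<omega>. mF L k *v \<xi> \<omega> + vg L k)"
    using ip_E_left[OF aN c A k_le] by (simp add: ip_commute)
  ultimately show ?thesis unfolding cost_linear_terminal_def by simp
qed

text \<open>The steps telescope backward from the terminal condition, which is the gradient of the
  terminal cost.\<close>

lemma Yproc_duality:
  assumes ub: "L2F M w k ub" and A: "A \<in> sets (F k)" and l: "k < l" "l \<le> N"
  shows "ip A (\<alpha> ub l) (Y l) =
    (\<Sum>j=l..<N. cost_linear L A k j (X j) (fbU \<Phi> v j (X j)) (\<alpha> ub j) (\<lambda>\<omega>. \<Phi> j *v \<alpha> ub j \<omega>))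
      + cost_linear_terminal L A k \<xi> (X N) (\<alpha> ub N)"
  using l(2,1)
proof (induction l rule: inc_induct)
  case base
  then show ?case using Yproc_duality_terminal[OF ub A] by simp
next
  case (step l)
  then show ?case using Yproc_duality_step[OF ub A, of l] by (simp add: sum.atLeast_Suc_lessThan)
qed

section \<open>The stationarity residual and the exact change of cost\<close>

definition residual :: "'a \<Rightarrow> real^'m" where
  "residual = (\<lambda>\<omega>. cR L k k *v (\<Phi> k *v X k \<omega> + v k \<omega>) + transpose (cB L k k) *v E k (Y (Suc k)) \<omega>
     + (\<Sum>i\<in>UNIV. transpose (cD L i k k) *v E k (\<lambda>\<eta>. (w k \<eta> $ i) *\<^sub>R Y (Suc k) \<eta>) \<omega>)
     + vrho L k k)"

lemma stationarity_iff: "stationarity M w L N t x \<Phi> v k \<longleftrightarrow> (AE \<omega> in M. residual \<omega> = 0)"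
  unfolding stationarity_def Let_def residual_def by (simp only: eq_commute[of 0])

lemma X_init: "X k = \<xi>"
  by (simp add: Xfb_def)

lemma L2F_Y_Suc: "L2F M w N (Y (Suc k))"
  using L2F_mono[OF L2F_Y[of "Suc k"], of N] k by simp

lemma L2F_u: "L2F M w k (\<lambda>\<omega>. \<Phi> k *v X k \<omega> + v k \<omega>)"
  by (intro L2F_add L2F_matrix L2F_X L2F_v k k_le order_refl)

text \<open>This makes the residual itself an admissible perturbation, the test direction used at
  the end.\<close>

lemma L2F_residual: "L2F M w k residual"
  unfolding residual_def
  by (intro L2F_add L2F_matrix L2F_sum L2F_const L2F_u L2F_E L2F_E_noise_le L2F_Y_Suc k k_le order_refl)

text \<open>The terms of the residual that contain Y are the adjoint of the first step of \<alpha>,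
  from \<open>ub\<close> to time \<open>Suc k\<close>.\<close>

lemma ip_residual:
  assumes ub: "L2F M w k ub" and A: "A \<in> sets (F k)"
  shows "ip A ub residual = ip A ub (\<lambda>\<omega>. cR L k k *v (\<Phi> k *v X k \<omega> + v k \<omega>)) + ip A ub (\<lambda>_. vrho L k k)
    + ip A (\<alpha> ub (Suc k)) (Y (Suc k))"
proof -
  note AM = sets_Fk[OF A] and kN = L2F_mono[OF _ k_le]
  have noise: "L2F M w N (\<lambda>\<omega>. w k \<omega> $ i *\<^sub>R V \<omega>)" if "L2F M w k V" for V :: "'a \<Rightarrow> real^'q::finite" and i
    using L2F_mono[OF L2F_noise[OF that k(2)]] k by simp
  have residual: "ip A ub residual = ip A ub (\<lambda>\<omega>. cR L k k *v (\<Phi> k *v X k \<omega> + v k \<omega>)) + ip A (\<lambda>\<omega>. cB L k k *v ub \<omega>) (E k (Y (Suc k)))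
     + (\<Sum>i\<in>UNIV. ip A (\<lambda>\<omega>. cD L i k k *v ub \<omega>) (E k (\<lambda>\<eta>. (w k \<eta> $ i) *\<^sub>R Y (Suc k) \<eta>)))
     + ip A ub (\<lambda>_. vrho L k k)"
    unfolding residual_def ip_transpose[symmetric]
    by (subst ip_add_right ip_sum_right, (intro L2F_add[where k = N] L2F_matrix[where k = N] L2F_sum[where k = N] L2F_const kN[OF L2F_u] kN[OF ub] L2F_N_E
        kN[OF L2F_E_noise_le] L2F_Y_Suc AM k k_le order_refl)+)+ (rule refl)
  have 1: "ip A (\<lambda>\<omega>. cB L k k *v ub \<omega>) (E k (Y (Suc k))) = ip A (\<lambda>\<omega>. cB L k k *v ub \<omega>) (Y (Suc k))"
    by (intro ip_E_right[OF _ L2F_Y_Suc A] L2F_matrix ub k_le order_refl)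
  have 2: "ip A (\<lambda>\<omega>. cD L i k k *v ub \<omega>) (E k (\<lambda>\<eta>. (w k \<eta> $ i) *\<^sub>R Y (Suc k) \<eta>))
      = ip A (\<lambda>\<omega>. w k \<omega> $ i *\<^sub>R (cD L i k k *v ub \<omega>)) (Y (Suc k))" for i
    by (intro ip_E_noise_right[OF _ L2F_Y_Suc A] L2F_matrix ub k k_le order_refl)
  have "ip A (\<alpha> ub (Suc k)) (Y (Suc k)) = ip A (\<lambda>\<omega>. cB L k k *v ub \<omega>) (Y (Suc k))
     + (\<Sum>i\<in>UNIV. ip A (\<lambda>\<omega>. w k \<omega> $ i *\<^sub>R (cD L i k k *v ub \<omega>)) (Y (Suc k)))"
    unfolding alpha_Suc_init
    by (subst ip_add_left ip_sum_left, (intro L2F_sum L2F_matrix noise kN[OF ub] ub L2F_Y_Suc AM k_le order_refl)+)+ (rule refl)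
  then show ?thesis unfolding residual 1 2 by simp
qed

text \<open>\<open>E k\<close> of zero is a version of zero, known only up to a null set, so it does
  not simplify away by itself.\<close>

lemma ip_E_zero_left:
  assumes "A \<in> sets (F k)" "L2F M w k Z"
  shows "ip A (E k (\<lambda>_. 0)) Z = 0"
  using ip_E_left[OF L2F_const assms(2,1) k_le] by simp

lemma ip_E_E_init:
  assumes ub: "L2F M w k ub" and u: "L2F M w k u" and A: "A \<in> sets (F k)"
  shows "ip A (E k ub) (\<lambda>\<omega>. mRb L k k *v E k u \<omega>) = ip A ub (\<lambda>\<omega>. mRb L k k *v u \<omega>)"
proof -
  note kN = L2F_mono[OF _ k_le]
  have eq: "AE \<omega> in M. mRb L k k *v E k u \<omega> = mRb L k k *v u \<omega>"
    using E_F_measurable[OF u k_le] by eventually_elim simp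
  show ?thesis
    by (rule ip_cong_AE[OF E_F_measurable[OF ub k_le] eq])
      (intro L2F_borel[where k = N] L2F_matrix[where k = N] L2F_N_E kN[OF ub] kN[OF u] sets_Fk[OF A] order_refl)+
qed

text \<open>The control varies by \<open>ub\<close> at time k and by \<Phi> times \<alpha> later. At
  time k, \<alpha> vanishes and only the control weight \<open>cR\<close> survives; afterwards the
  control weights are absorbed into the state weights.\<close>

lemma cost_quadratic_eq_cost_tilde:
  assumes ub: "L2F M w k ub" and A: "A \<in> sets (F k)"
  shows "(\<Sum>l=k..<N. cost_quadratic L A k l (\<alpha> ub l) (if l = k then ub else (\<lambda>\<omega>. \<Phi> l *v \<alpha> ub l \<omega>)))
      + ip A (\<alpha> ub N) (\<lambda>\<omega>. mG L k *v \<alpha> ub N \<omega>) + ip A (E k (\<alpha> ub N)) (\<lambda>\<omega>. mGb L k *v E k (\<alpha> ub N) \<omega>)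
    = cost_tilde L A k \<Phi> (alpha M w L k \<Phi> ub) ub"
proof -
  note AM = sets_Fk[OF A] and kN = L2F_mono[OF _ k_le]
  have zero: "L2F M w k (\<lambda>\<omega>. V *v E k (\<lambda>_. 0) \<omega>)" for V :: "real^'n^'n"
    by (intro L2F_matrix L2F_E L2F_const k_le)
  have init: "cost_quadratic L A k k (\<alpha> ub k) ub = ip A ub (\<lambda>\<omega>. cR L k k *v ub \<omega>)"
    unfolding cost_quadratic_def alpha_init ip_E_E_init[OF ub ub A] ip_E_zero_left[OF A zero] cR_def matrix_vector_mult_add_rdistrib
    by (subst ip_add_right) (auto intro: L2F_matrix kN ub AM)
  have init': "ip A (E k (\<alpha> ub k)) (\<lambda>\<omega>. V *v E k (\<alpha> ub k) \<omega>) = 0" for V :: "real^'n^'n"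
    unfolding alpha_init by (rule ip_E_zero_left[OF A zero])
  have quad: "(\<lambda>\<omega>. (V + transpose (\<Phi> l) ** R ** \<Phi> l) *v b \<omega>) = (\<lambda>\<omega>. V *v b \<omega> + transpose (\<Phi> l) *v (R *v (\<Phi> l *v b \<omega>)))"
    for V R l and b :: "'a \<Rightarrow> real^'n"
    by (simp only: matrix_vector_mult_add_rdistrib matrix_vector_mul_assoc matrix_mul_assoc)
  have step: "cost_quadratic L A k l (\<alpha> ub l) (if l = k then ub else (\<lambda>\<omega>. \<Phi> l *v \<alpha> ub l \<omega>))
    = ip A (\<alpha> ub l) (\<lambda>\<omega>. (mQ L k l + transpose (\<Phi> l) ** mR L k l ** \<Phi> l) *v \<alpha> ub l \<omega>)
       + ip A (E k (\<alpha> ub l)) (\<lambda>\<omega>. (mQb L k l + transpose (\<Phi> l) ** mRb L k l ** \<Phi> l) *v E k (\<alpha> ub l) \<omega>)"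
    if l: "l \<in> {Suc k..<N}" for l
  proof -
    have aN: "L2F M w N (\<alpha> ub l)" using l by (intro L2F_mono[OF L2F_alpha[OF ub]]) auto
    note E = E_matrix[OF aN k_le, of "\<Phi> l"]
    have E': "AE \<omega> in M. mRb L k l *v E k (\<lambda>\<omega>. \<Phi> l *v \<alpha> ub l \<omega>) \<omega> = mRb L k l *v (\<Phi> l *v E k (\<alpha> ub l) \<omega>)"
      using E by eventually_elim simp
    have "ip A (E k (\<lambda>\<omega>. \<Phi> l *v \<alpha> ub l \<omega>)) (\<lambda>\<omega>. mRb L k l *v E k (\<lambda>\<omega>. \<Phi> l *v \<alpha> ub l \<omega>) \<omega>)
        = ip A (\<lambda>\<omega>. \<Phi> l *v E k (\<alpha> ub l) \<omega>) (\<lambda>\<omega>. mRb L k l *v (\<Phi> l *v E k (\<alpha> ub l) \<omega>))"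
      by (rule ip_cong_AE[OF E E']; (intro L2F_borel[where k = N] L2F_matrix L2F_N_E aN AM order_refl)?)
    moreover have "(if l = k then ub else (\<lambda>\<omega>. \<Phi> l *v \<alpha> ub l \<omega>)) = (\<lambda>\<omega>. \<Phi> l *v \<alpha> ub l \<omega>)" using l by auto
    moreover have "ip A (\<alpha> ub l) (\<lambda>\<omega>. mQ L k l *v \<alpha> ub l \<omega> + transpose (\<Phi> l) *v (mR L k l *v (\<Phi> l *v \<alpha> ub l \<omega>)))
        = ip A (\<alpha> ub l) (\<lambda>\<omega>. mQ L k l *v \<alpha> ub l \<omega>) + ip A (\<lambda>\<omega>. \<Phi> l *v \<alpha> ub l \<omega>) (\<lambda>\<omega>. mR L k l *v (\<Phi> l *v \<alpha> ub l \<omega>))"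
      unfolding ip_transpose[symmetric] by (intro ip_add_right L2F_matrix aN AM order_refl)
    moreover have "ip A (E k (\<alpha> ub l)) (\<lambda>\<omega>. mQb L k l *v E k (\<alpha> ub l) \<omega> + transpose (\<Phi> l) *v (mRb L k l *v (\<Phi> l *v E k (\<alpha> ub l) \<omega>)))
        = ip A (E k (\<alpha> ub l)) (\<lambda>\<omega>. mQb L k l *v E k (\<alpha> ub l) \<omega>)
         + ip A (\<lambda>\<omega>. \<Phi> l *v E k (\<alpha> ub l) \<omega>) (\<lambda>\<omega>. mRb L k l *v (\<Phi> l *v E k (\<alpha> ub l) \<omega>))"
      unfolding ip_transpose[symmetric] by (intro ip_add_right L2F_matrix L2F_N_E aN AM order_refl)
    ultimately show ?thesis unfolding cost_quadratic_def quad by simp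
  qed
  have "(\<Sum>l=Suc k..<N. cost_quadratic L A k l (\<alpha> ub l) (if l = k then ub else (\<lambda>\<omega>. \<Phi> l *v \<alpha> ub l \<omega>)))
    = (\<Sum>l=Suc k..<N. ip A (\<alpha> ub l) (\<lambda>\<omega>. (mQ L k l + transpose (\<Phi> l) ** mR L k l ** \<Phi> l) *v \<alpha> ub l \<omega>)
       + ip A (E k (\<alpha> ub l)) (\<lambda>\<omega>. (mQb L k l + transpose (\<Phi> l) ** mRb L k l ** \<Phi> l) *v E k (\<alpha> ub l) \<omega>))"
    by (intro sum.cong refl step)
  then show ?thesis
    unfolding cost_tilde_def sum.atLeast_Suc_lessThan[OF k(2)] init' if_P[OF refl] init by simp
qed

lemma cost_difference:
  assumes ub: "L2F M w k ub" and A: "A \<in> sets (F k)"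
  defines "u \<equiv> \<lambda>\<omega>. fbU \<Phi> v k \<xi> \<omega> + ub \<omega>"
  shows "cost L A k \<xi> (state M w L k \<xi> (mixU k u \<Phi> v)) (\<lambda>l. mixU k u \<Phi> v l (state M w L k \<xi> (mixU k u \<Phi> v) l))
    = cost L A k \<xi> X (\<lambda>l. fbU \<Phi> v l (X l)) + cost_tilde L A k \<Phi> (alpha M w L k \<Phi> ub) ub + 2 * ip A ub residual"
proof -
  note AM = sets_Fk[OF A] and kN = L2F_mono[OF _ k_le]
  let ?X' = "state M w L k \<xi> (mixU k u \<Phi> v)"
  let ?b = "\<lambda>l. if l = k then ub else (\<lambda>\<omega>. \<Phi> l *v \<alpha> ub l \<omega>)"
  have u: "L2F M w k u" unfolding u_def using k by (intro L2F_add L2F_fbU L2F_initial L2F_v ub) auto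
  have X': "L2F M w l (?X' l)" if "k \<le> l" "l \<le> N" for l
    by (intro L2F_state L2F_initial L2F_mixU L2F_v u) (use that k in auto)
  have pert: "AE \<omega> in M. ?X' l \<omega> = X l \<omega> + \<alpha> ub l \<omega>" if "k \<le> l" "l \<le> N" for l
    unfolding Xfb_def u_def using that k by (intro state_perturbation L2F_initial L2F_v ub) auto
  have "cost L A k \<xi> ?X' (\<lambda>l. mixU k u \<Phi> v l (?X' l)) = cost L A k \<xi> X (\<lambda>l. fbU \<Phi> v l (X l))
     + ((\<Sum>l=k..<N. cost_quadratic L A k l (\<alpha> ub l) (?b l))
         + ip A (\<alpha> ub N) (\<lambda>\<omega>. mG L k *v \<alpha> ub N \<omega>) + ip A (E k (\<alpha> ub N)) (\<lambda>\<omega>. mGb L k *v E k (\<alpha> ub N) \<omega>))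
     + 2 * ((\<Sum>l=k..<N. cost_linear L A k l (X l) (fbU \<Phi> v l (X l)) (\<alpha> ub l) (?b l)) + cost_linear_terminal L A k \<xi> (X N) (\<alpha> ub N))"
  proof (rule cost_perturbation[OF k(2) A L2F_initial])
    fix l assume l: "k \<le> l" "l \<le> N"
    show "L2F M w N (X l)" "L2F M w N (\<alpha> ub l)" "L2F M w N (?X' l)"
      using L2F_mono[OF L2F_X[OF l] l(2)] L2F_mono[OF L2F_alpha[OF ub l] l(2)] L2F_mono[OF X'[OF l] l(2)] .
    show "AE \<omega> in M. ?X' l \<omega> = X l \<omega> + \<alpha> ub l \<omega>" by (rule pert[OF l])
  next
    fix l assume l: "k \<le> l" "l < N"
    then have l': "l \<le> N" "t \<le> l" using k by auto
    show "L2F M w N (fbU \<Phi> v l (X l))"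
      by (rule L2F_mono[OF L2F_fbU[OF L2F_X L2F_v]]) (use l l' in auto)
    show "L2F M w N (?b l)"
      using kN[OF ub] L2F_mono[OF L2F_matrix[OF L2F_alpha[OF ub l(1) l'(1)] l'(1)] l'(1)] by auto
    show "L2F M w N (mixU k u \<Phi> v l (?X' l))"
      by (rule L2F_mono[OF L2F_mixU[OF X' L2F_v]]) (use l l' u in auto)
    show "AE \<omega> in M. mixU k u \<Phi> v l (?X' l) \<omega> = fbU \<Phi> v l (X l) \<omega> + ?b l \<omega>"
    proof (cases "l = k")
      case True then show ?thesis by (simp add: mixU_def u_def X_init)
    next
      case False
      then have "mixU k u \<Phi> v l (?X' l) = fbU \<Phi> v l (?X' l)" by (simp add: mixU_def)
      with False pert[OF l(1) l'(1)] show ?thesis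
        unfolding fbU_def by (auto elim!: eventually_mono simp: matrix_vector_right_distrib)
    qed
  qed (use symmetric[of k] symmetric_terminal[OF k(2)] in auto)
  also have "(\<Sum>l=k..<N. cost_linear L A k l (X l) (fbU \<Phi> v l (X l)) (\<alpha> ub l) (?b l)) + cost_linear_terminal L A k \<xi> (X N) (\<alpha> ub N)
    = ip A ub residual"
  proof -
    have lin: "(\<Sum>l=Suc k..<N. cost_linear L A k l (X l) (fbU \<Phi> v l (X l)) (\<alpha> ub l) (?b l))
      = (\<Sum>l=Suc k..<N. cost_linear L A k l (X l) (fbU \<Phi> v l (X l)) (\<alpha> ub l) (\<lambda>\<omega>. \<Phi> l *v \<alpha> ub l \<omega>))"
      by (intro sum.cong) auto
    have zero: "L2F M w k (\<lambda>\<omega>. V *v E k (X k) \<omega>)" for V :: "real^'n^'n"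
      by (intro L2F_matrix L2F_E kN L2F_X k_le order_refl)
    have init: "cost_linear L A k k (X k) (fbU \<Phi> v k (X k)) (\<alpha> ub k) ub
      = ip A ub (\<lambda>\<omega>. cR L k k *v (\<Phi> k *v X k \<omega> + v k \<omega>)) + ip A ub (\<lambda>_. vrho L k k)"
    proof -
      have "ip A ub (\<lambda>\<omega>. cR L k k *v (\<Phi> k *v X k \<omega> + v k \<omega>)) =
        ip A ub (\<lambda>\<omega>. mR L k k *v (\<Phi> k *v X k \<omega> + v k \<omega>)) + ip A ub (\<lambda>\<omega>. mRb L k k *v (\<Phi> k *v X k \<omega> + v k \<omega>))"
        unfolding cR_def matrix_vector_mult_add_rdistrib
        by (intro ip_add_right L2F_matrix kN[OF L2F_u] kN[OF ub] AM order_refl)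
      then show ?thesis
        unfolding cost_linear_def alpha_init ip_E_zero_left[OF A zero] ip_commute[of A "\<lambda>_. vq L k k"]
          ip_commute[of A "\<lambda>_. vrho L k k"] fbU_def ip_E_E_init[OF ub L2F_u A] ip_zero_left
        by simp
    qed
    have "Suc k \<le> N" using k by simp
    \<comment> \<open>The summand at k supplies the control terms of the residual; the later
      summands and the terminal part collapse to the pairing of \<alpha> with Y at
      \<open>Suc k\<close>.\<close>
    from Yproc_duality[OF ub A lessI this] show ?thesis
      unfolding sum.atLeast_Suc_lessThan[OF k(2)] lin if_P[OF refl] init ip_residual[OF ub A] by linarith
  qed
  finally show ?thesis
    unfolding cost_quadratic_eq_cost_tilde[OF ub A] .
qed

lemma Jcost_difference:
  assumes ub: "L2F M w k ub"
  defines "u \<equiv> \<lambda>\<omega>. fbU \<Phi> v k \<xi> \<omega> + ub \<omega>"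
  shows "AE \<omega> in M. Jcost M w L N k \<xi> (mixU k u \<Phi> v) \<omega>
    = Jcost M w L N k \<xi> (fbU \<Phi> v) \<omega> + Jtilde M w L N k \<Phi> ub \<omega> + 2 * (ub \<omega> \<bullet> residual \<omega>)"
proof (rule AE_eq_of_F_integrals[OF k_le])
  fix A assume A: "A \<in> sets (F k)"
  have u: "L2F M w k u" unfolding u_def using k by (intro L2F_add L2F_fbU L2F_initial L2F_v ub) auto
  show "has_F_int k A (Jcost M w L N k \<xi> (mixU k u \<Phi> v))
    (cost L A k \<xi> (state M w L k \<xi> (mixU k u \<Phi> v)) (\<lambda>l. mixU k u \<Phi> v l (state M w L k \<xi> (mixU k u \<Phi> v) l)))"
    using k by (intro has_F_int_Jcost L2F_initial L2F_mixU L2F_v u A) auto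
  show "has_F_int k A (\<lambda>\<omega>. Jcost M w L N k \<xi> (fbU \<Phi> v) \<omega> + Jtilde M w L N k \<Phi> ub \<omega> + 2 * (ub \<omega> \<bullet> residual \<omega>))
    (cost L A k \<xi> (state M w L k \<xi> (mixU k u \<Phi> v)) (\<lambda>l. mixU k u \<Phi> v l (state M w L k \<xi> (mixU k u \<Phi> v) l)))"
    unfolding u_def cost_difference[OF ub A] unfolding Xfb_def
    using k by (intro has_F_int_add has_F_int_cmult has_F_int_inner has_F_int_Jcost has_F_int_Jtilde
        L2F_initial L2F_fbU L2F_v L2F_residual ub A sets_Fk) auto
qed

section \<open>The variational argument at a single time\<close>

lemma equilibrium_at_iff:
  "(\<forall>u. L2F M w k u \<longrightarrow> (AE \<omega> in M. Jcost M w L N k \<xi> (fbU \<Phi> v) \<omega> \<le> Jcost M w L N k \<xi> (mixU k u \<Phi> v) \<omega>))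
    \<longleftrightarrow> stationarity M w L N t x \<Phi> v k \<and> convexity M w L N \<Phi> k"
proof
  assume sc: "stationarity M w L N t x \<Phi> v k \<and> convexity M w L N \<Phi> k"
  show "\<forall>u. L2F M w k u \<longrightarrow> (AE \<omega> in M. Jcost M w L N k \<xi> (fbU \<Phi> v) \<omega> \<le> Jcost M w L N k \<xi> (mixU k u \<Phi> v) \<omega>)"
  proof (intro allI impI)
    fix u :: "'a \<Rightarrow> real^'m" assume u: "L2F M w k u"
    \<comment> \<open>Every admissible control is the feedback control plus an admissible
      perturbation, so perturbations exhaust all competitors.\<close>
    let ?ub = "\<lambda>\<omega>. u \<omega> - fbU \<Phi> v k \<xi> \<omega>"
    have ub: "L2F M w k ?ub"
      using k by (intro L2F_diff L2F_fbU L2F_initial L2F_v u) auto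
    have "AE \<omega> in M. residual \<omega> = 0" "AE \<omega> in M. 0 \<le> Jtilde M w L N k \<Phi> ?ub \<omega>"
      using sc ub unfolding stationarity_iff convexity_def by auto
    moreover have "AE \<omega> in M. Jcost M w L N k \<xi> (mixU k u \<Phi> v) \<omega>
      = Jcost M w L N k \<xi> (fbU \<Phi> v) \<omega> + Jtilde M w L N k \<Phi> ?ub \<omega> + 2 * (?ub \<omega> \<bullet> residual \<omega>)"
      using Jcost_difference[OF ub] by simp
    ultimately show "AE \<omega> in M. Jcost M w L N k \<xi> (fbU \<Phi> v) \<omega> \<le> Jcost M w L N k \<xi> (mixU k u \<Phi> v) \<omega>"
      by eventually_elim simp
  qed
next
  assume opt: "\<forall>u. L2F M w k u \<longrightarrow> (AE \<omega> in M. Jcost M w L N k \<xi> (fbU \<Phi> v) \<omega> \<le> Jcost M w L N k \<xi> (mixU k u \<Phi> v) \<omega>)"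
  have pos: "AE \<omega> in M. 0 \<le> c\<^sup>2 * Jtilde M w L N k \<Phi> ub \<omega> + 2 * c * (ub \<omega> \<bullet> residual \<omega>)"
    if ub: "L2F M w k ub" for ub c
  proof -
    have cub: "L2F M w k (\<lambda>\<omega>. c *\<^sub>R ub \<omega>)" by (rule L2F_scaleR[OF ub])
    have u: "L2F M w k (\<lambda>\<omega>. fbU \<Phi> v k \<xi> \<omega> + c *\<^sub>R ub \<omega>)"
      using k by (intro L2F_add L2F_fbU L2F_initial L2F_v cub) auto
    show ?thesis
      using opt[rule_format, OF u] Jcost_difference[OF cub] Jtilde_scaleR[OF ub k_le, of L \<Phi> c]
      by eventually_elim simp
  qed
  have conv: "AE \<omega> in M. 0 \<le> Jtilde M w L N k \<Phi> ub \<omega>" if "L2F M w k ub" for ub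
    using pos[OF that, of 1] pos[OF that, of "-1"] by eventually_elim simp
  \<comment> \<open>Countably many scalings suffice, so their null sets can be united;
    \<open>Suc n\<close> avoids division by zero.\<close>
  have "AE \<omega> in M. \<forall>n::nat. 0 \<le> (- 1 / real (Suc n))\<^sup>2 * Jtilde M w L N k \<Phi> residual \<omega> + 2 * (- 1 / real (Suc n)) * (residual \<omega> \<bullet> residual \<omega>)"
    using pos[OF L2F_residual] by (subst AE_all_countable) blast
  then have "AE \<omega> in M. residual \<omega> = 0"
  proof eventually_elim
    fix \<omega>
    assume n: "\<forall>n::nat. 0 \<le> (- 1 / real (Suc n))\<^sup>2 * Jtilde M w L N k \<Phi> residual \<omega> + 2 * (- 1 / real (Suc n)) * (residual \<omega> \<bullet> residual \<omega>)"
    \<comment> \<open>Multiplying by the squared scale makes the quadratic part independent of n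
      while the linear part grows with n; a nonzero residual would then contradict the Archimedean
      property.\<close>
    have le: "real (Suc n) * (2 * (residual \<omega> \<bullet> residual \<omega>)) \<le> Jtilde M w L N k \<Phi> residual \<omega>" for n
    proof -
      have "0 \<le> (real (Suc n))\<^sup>2 * ((- 1 / real (Suc n))\<^sup>2 * Jtilde M w L N k \<Phi> residual \<omega> + 2 * (- 1 / real (Suc n)) * (residual \<omega> \<bullet> residual \<omega>))"
        using n by (intro mult_nonneg_nonneg) auto
      also have "\<dots> = Jtilde M w L N k \<Phi> residual \<omega> - real (Suc n) * (2 * (residual \<omega> \<bullet> residual \<omega>))"
        by (simp add: power2_eq_square field_simps del: of_nat_Suc)
      finally show ?thesis by simp
    qed
    show "residual \<omega> = 0"
    proof (rule ccontr)
      assume "residual \<omega> \<noteq> 0"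
      then have "0 < 2 * (residual \<omega> \<bullet> residual \<omega>)" by simp
      then obtain n where "Jtilde M w L N k \<Phi> residual \<omega> < real n * (2 * (residual \<omega> \<bullet> residual \<omega>))"
        using ex_less_of_nat_mult by blast
      also have "\<dots> \<le> real (Suc n) * (2 * (residual \<omega> \<bullet> residual \<omega>))" by (intro mult_right_mono) auto
      finally show False using le[of n] by simp
    qed
  qed
  with conv show "stationarity M w L N t x \<Phi> v k \<and> convexity M w L N \<Phi> k"
    unfolding stationarity_iff convexity_def by blast
qed

end

theorem mainTheorem2:
  fixes M :: "'a measure" and w :: "nat \<Rightarrow> 'a \<Rightarrow> real^'p::finite"
    and \<Delta> :: "nat \<Rightarrow> real^'p^'p" and L :: "('n::finite,'m::finite,'p) lqdata"
    and N t :: nat and x :: "'a \<Rightarrow> real^'n"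
  assumes "standing M w \<Delta> L N"
    and "t < N"
    and "L2F M w t x"
  shows "((\<exists>(\<Phi> :: nat \<Rightarrow> real^'n^'m) v. mixed_equilibrium M w L N t x \<Phi> v)
          \<longleftrightarrow> (\<exists>(\<Phi> :: nat \<Rightarrow> real^'n^'m) v. (\<forall>k. t \<le> k \<and> k < N \<longrightarrow> L2F M w k (v k)) \<and>
                 (\<forall>k. t \<le> k \<and> k < N \<longrightarrow>
                     stationarity M w L N t x \<Phi> v k \<and> convexity M w L N \<Phi> k)))
       \<and> (\<forall>(\<Phi> :: nat \<Rightarrow> real^'n^'m) v. (\<forall>k. t \<le> k \<and> k < N \<longrightarrow> L2F M w k (v k)) \<and>
                 (\<forall>k. t \<le> k \<and> k < N \<longrightarrow>
                     stationarity M w L N t x \<Phi> v k \<and> convexity M w L N \<Phi> k)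
              \<longrightarrow> mixed_equilibrium M w L N t x \<Phi> v)"
proof -
  \<comment> \<open>The equivalence holds for each individual pair, so it yields both the existence
    statement and the final assertion about the same pair.\<close>
  have iff: "mixed_equilibrium M w L N t x \<Phi> v \<longleftrightarrow> (\<forall>k. t \<le> k \<and> k < N \<longrightarrow> L2F M w k (v k)) \<and>
      (\<forall>k. t \<le> k \<and> k < N \<longrightarrow> stationarity M w L N t x \<Phi> v k \<and> convexity M w L N \<Phi> k)"
    for \<Phi> :: "nat \<Rightarrow> real^'n^'m" and v
  \<comment> \<open>If \<open>v\<close> is not admissible, both sides are false by definition;
    otherwise the locale applies at every k.\<close>
  proof (cases "\<forall>k. t \<le> k \<and> k < N \<longrightarrow> L2F M w k (v k)")
    case v: True
    have "lq_problem M w N \<Delta> L t x v k" if "t \<le> k" "k < N" for k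
      using assms v that
      by (auto simp: standing_def lq_problem_def lq_problem_axioms_def square_integrable_noise_def
          square_integrable_noise_axioms_def)
    from lq_problem.equilibrium_at_iff[OF this, of _ \<Phi>] show ?thesis
      unfolding mixed_equilibrium_def using v by blast
  qed (auto simp: mixed_equilibrium_def)
  show ?thesis unfolding iff by blast
qed

end
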